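(* Let $k$ be an algebraically closed field of characteristic zero, let $q\in k^*$ be not a root of unity, let $a_1,a_2\in k[h]$ be non-constant polynomials, and let $\sigma$ be the $k$-algebra automorphism of $k[h]$ with $\sigma(h)=qh$. Then there is an isomorphism of $k$-algebras $\Phi$ from the quantum generalized Weyl algebra $A_q(a_1)=k[h](\sigma,a_1)$ onto $A_q(a_2)=k[h](\sigma,a_2)$ if and only if there exist $\alpha,\rho\in k^*$ such that $a_2(h)=\rho\, a_1(\alpha h)$.
   Context: For a $k$-algebra automorphism $\sigma$ of $k[h]$ and a nonzero polynomial $a\in k[h]$, the generalized Weyl algebra $k[h](\sigma,a)$ is the (unital, associative) $k$-algebra generated over $k[h]$ by two generators $x,y$ with relations $xh=\sigma(h)x$, $yh=\sigma^{-1}(h)y$, $xy=\sigma(a)$, $yx=a$. *)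

theory Defs
  imports
    "HOL-Computational_Algebra.Polynomial"
    "HOL-Library.Poly_Mapping"
    "HOL-Algebra.QuotRing"
    "HOL-Algebra.Algebraic_Closure_Type"
begin

text \<open>
  Words form a monoid, written additively only because \<^typ>\<open>'a \<Rightarrow>\<^sub>0 'b\<close> takes its convolution
  product from \<^class>\<open>monoid_add\<close>. This addition is concatenation and is not commutative,
  so the finitely supported functions on words are the free associative algebra.
\<close>

datatype 'g word = Word (letters: "'g list")

instantiation word :: (type) monoid_add
begin

definition zero_word :: "'a word"
  where "0 = Word []"

definition plus_word :: "'a word \<Rightarrow> 'a word \<Rightarrow> 'a word"
  where "u + v = Word (letters u @ letters v)"

instance
  by standard (simp_all add: zero_word_def plus_word_def)

end

type_synonym ('g, 'k) free_algebra = "'g word \<Rightarrow>\<^sub>0 'k"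

definition free_gen :: "'g \<Rightarrow> ('g, 'k::comm_ring_1) free_algebra"
  where "free_gen g = Poly_Mapping.single (Word [g]) 1"

definition free_scalar :: "'k::comm_ring_1 \<Rightarrow> ('g, 'k) free_algebra"
  where "free_scalar c = Poly_Mapping.single 0 c"

definition free_poly :: "'k::comm_ring_1 poly \<Rightarrow> ('g, 'k) free_algebra \<Rightarrow> ('g, 'k) free_algebra"
  where "free_poly p u = (\<Sum>i\<le>degree p. free_scalar (coeff p i) * u ^ i)"

abbreviation free_ring :: "('g, 'k::comm_ring_1) free_algebra ring"
  where "free_ring \<equiv> ring_of_type_algebra"

text \<open>
  The record type \<^typ>\<open>('k, 'a) module\<close> of HOL-Algebra is used for a (possibly noncommutative)
  associative unital algebra with carrier in \<^typ>\<open>'a\<close> over a field that is a whole type \<^typ>\<open>'k\<close>.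
  In the following definition \<open>R\<close> is a set of elements that are to become zero.
\<close>

definition presented_algebra ::
  "('g, 'k::comm_ring_1) free_algebra set \<Rightarrow> ('k, ('g, 'k) free_algebra set) module"
  where
  "presented_algebra R =
     (let I = Idl\<^bsub>free_ring\<^esub> R; Q = free_ring Quot I in
      \<lparr>carrier = carrier Q, monoid.mult = monoid.mult Q, one = one Q, ring.zero = ring.zero Q,
       add = add Q,
       module.smult = (\<lambda>c U. (I +>\<^bsub>free_ring\<^esub> free_scalar c) \<otimes>\<^bsub>Q\<^esub> U)\<rparr>)"

definition alg_iso :: "('k, 'a, 'm) module_scheme \<Rightarrow> ('k, 'b, 'n) module_scheme \<Rightarrow> ('a \<Rightarrow> 'b) set"
  where
  "alg_iso A B =
     {\<Phi> \<in> ring_iso A B. \<forall>c. \<forall>u\<in>carrier A. \<Phi> (c \<odot>\<^bsub>A\<^esub> u) = c \<odot>\<^bsub>B\<^esub> \<Phi> u}"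


definition poly_alg_automorphism :: "('k::comm_ring_1 poly \<Rightarrow> 'k poly) \<Rightarrow> bool"
  where
  "poly_alg_automorphism \<sigma> \<longleftrightarrow>
     bij \<sigma> \<and> \<sigma> 1 = 1 \<and>
     (\<forall>p r. \<sigma> (p + r) = \<sigma> p + \<sigma> r) \<and>
     (\<forall>p r. \<sigma> (p * r) = \<sigma> p * \<sigma> r) \<and>
     (\<forall>c p. \<sigma> (Polynomial.smult c p) = Polynomial.smult c (\<sigma> p))"

abbreviation poly_h :: "'k::comm_ring_1 poly"
  where "poly_h \<equiv> [:0, 1:]"

datatype gwa_gen = Gen_h | Gen_x | Gen_y

text \<open>
  The algebra generated over \<open>k[h]\<close> by \<open>x\<close> and \<open>y\<close> is presented as a \<open>k\<close>-algebra on
  \<open>h\<close>, \<open>x\<close>, \<open>y\<close>; a polynomial in \<open>k[h]\<close> enters a relation by evaluation at the generator \<open>h\<close>.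
\<close>

definition gwa_relations ::
  "('k::comm_ring_1 poly \<Rightarrow> 'k poly) \<Rightarrow> 'k poly \<Rightarrow> (gwa_gen, 'k) free_algebra set"
  where
  "gwa_relations \<sigma> a =
     (let h = free_gen Gen_h; x = free_gen Gen_x; y = free_gen Gen_y in
      {x * h - free_poly (\<sigma> poly_h) h * x,
       y * h - free_poly (inv_into UNIV \<sigma> poly_h) h * y,
       x * y - free_poly (\<sigma> a) h,
       y * x - free_poly a h})"

definition gwa ::
  "('k::comm_ring_1 poly \<Rightarrow> 'k poly) \<Rightarrow> 'k poly \<Rightarrow> ('k, (gwa_gen, 'k) free_algebra set) module"
  where "gwa \<sigma> a = presented_algebra (gwa_relations \<sigma> a)"

end

theory Submission
  imports Defs
begin

text \<open>
  Let \<open>x\<close> act on two-sided sequences by the shift, \<open>h\<close> by multiplication with \<open>n \<mapsto> q\<^sup>n\<close> and \<open>y\<close> by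
  \<open>a(h) x\<^sup>-\<^sup>1\<close>. As \<open>q\<close> is not a root of unity, this represents \<open>A\<^sub>q(a)\<close> faithfully as a subalgebra of the
  skew Laurent polynomials \<open>\<Sum>\<^sub>i p\<^sub>i(h) x\<^sup>i\<close>, in which the component in degree \<open>-1\<close> is divisible by \<open>a\<close>.

  An isomorphism preserves normal elements. Comparing extreme degrees, a normal element is a
  monomial \<open>c h\<^sup>j x\<^sup>i\<close>, and \<open>i \<noteq> 0\<close> forces \<open>a\<close> to be a monomial. If \<open>h\<close> and its preimage have degree \<open>0\<close>,
  then \<open>h \<mapsto> \<alpha> h\<close>, so the images of \<open>x\<close> and \<open>y\<close> have degrees \<open>1\<close> and \<open>-1\<close>, and \<open>y x = a\<^sub>1(h)\<close> shows that
  \<open>a\<^sub>2\<close> divides \<open>a\<^sub>1(\<alpha> h)\<close>; by symmetry the degrees agree. Otherwise both polynomials are monomials,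
  and their degrees agree by a lattice argument on the exponents of normal elements.
\<close>

section \<open>Linear operators on two-sided sequences\<close>

text \<open>A type rather than a carrier set, so that the \<open>ring_1\<close> instance supplies
  the ring laws and \<open>ring_of_type_algebra\<close> can serve as the target of evaluation
  maps.\<close>

typedef (overloaded) 'k linop =
  "{T :: (int \<Rightarrow> 'k::field) \<Rightarrow> int \<Rightarrow> 'k.
      \<forall>c d u v. T (\<lambda>n. c * u n + d * v n) = (\<lambda>n. c * T u n + d * T v n)}"
  morphisms app_linop Abs_linop
  by (rule exI[of _ id]) simp

setup_lifting type_definition_linop

lemma app_linop_linear:
  "app_linop T (\<lambda>n. c * u n + d * v n) = (\<lambda>n. c * app_linop T u n + d * app_linop T v n)"
  using app_linop[of T] by blast

lemma linop_eqI: "(\<And>u n. app_linop S u n = app_linop T u n) \<Longrightarrow> S = T"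
  by (metis app_linop_inject ext)

instantiation linop :: (field) ring_1
begin

lift_definition zero_linop :: "'a linop" is "\<lambda>_ _. 0" by simp
lift_definition one_linop :: "'a linop" is "\<lambda>u. u" by simp
lift_definition plus_linop :: "'a linop \<Rightarrow> 'a linop \<Rightarrow> 'a linop" is "\<lambda>S T u n. S u n + T u n"
  by (simp add: algebra_simps)
lift_definition minus_linop :: "'a linop \<Rightarrow> 'a linop \<Rightarrow> 'a linop" is "\<lambda>S T u n. S u n - T u n"
  by (simp add: algebra_simps)
lift_definition uminus_linop :: "'a linop \<Rightarrow> 'a linop" is "\<lambda>T u n. - T u n"
  by (simp add: algebra_simps)
lift_definition times_linop :: "'a linop \<Rightarrow> 'a linop \<Rightarrow> 'a linop" is "\<lambda>S T u. S (T u)"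
  by simp

instance
proof
  fix a b c :: "'a linop"
  have add: "app_linop a (\<lambda>n. u n + v n) = (\<lambda>n. app_linop a u n + app_linop a v n)" for u v
    using app_linop_linear[of a 1 u 1 v] by simp
  show "a * (b + c) = a * b + a * c"
    by (rule linop_eqI) (simp add: times_linop.rep_eq plus_linop.rep_eq add)
  have "app_linop (0 :: 'a linop) (\<lambda>_. 1) 0 \<noteq> app_linop 1 (\<lambda>_. 1) 0"
    by (simp add: zero_linop.rep_eq one_linop.rep_eq)
  then show "(0 :: 'a linop) \<noteq> 1" by metis
qed (rule linop_eqI; simp add: times_linop.rep_eq plus_linop.rep_eq minus_linop.rep_eq
      uminus_linop.rep_eq zero_linop.rep_eq one_linop.rep_eq algebra_simps)+

end

lift_definition scal :: "'k::field \<Rightarrow> 'k linop" is "\<lambda>c u n. c * u n"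
  by (simp add: algebra_simps)

lemma scal_comm: "T * scal c = scal c * T"
proof (rule linop_eqI)
  fix u n
  have "app_linop T (\<lambda>n. c * u n) n = c * app_linop T u n"
    using app_linop_linear[of T c u 0 u] by simp
  then show "app_linop (T * scal c) u n = app_linop (scal c * T) u n"
    by (simp add: times_linop.rep_eq scal.rep_eq)
qed

lemma scal_mult: "scal (c * d) = scal c * scal d"
  by (rule linop_eqI) (simp add: times_linop.rep_eq scal.rep_eq)

lemma scal_add: "scal (c + d) = scal c + scal d"
  by (rule linop_eqI) (simp add: plus_linop.rep_eq scal.rep_eq algebra_simps)

lemma scal_0 [simp]: "scal 0 = 0"
  by (rule linop_eqI) (simp add: zero_linop.rep_eq scal.rep_eq)

lemma scal_1 [simp]: "scal 1 = 1"
  by (rule linop_eqI) (simp add: one_linop.rep_eq scal.rep_eq)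

definition op_algebra :: "'k::field linop set \<Rightarrow> ('k, 'k linop) module"
  where "op_algebra S = \<lparr>carrier = S, monoid.mult = (*), one = 1, ring.zero = 0, add = (+),
    module.smult = (\<lambda>c u. scal c * u)\<rparr>"

lemma op_algebra_simps [simp]:
  "carrier (op_algebra S) = S" "monoid.mult (op_algebra S) = (*)" "one (op_algebra S) = 1"
  "ring.zero (op_algebra S) = 0" "add (op_algebra S) = (+)"
  "module.smult (op_algebra S) = (\<lambda>c u. scal c * u)"
  by (simp_all add: op_algebra_def)

section \<open>Evaluation of the free algebra\<close>

text \<open>Additive statements on the free algebra reduce to one term at a time. The key inserted
  by \<open>update_induct\<close> is fresh, so the update is a sum.\<close>

lemma poly_mapping_single_add_induct [case_names zero single_add]:
  assumes "P 0" and "\<And>w c p. P p \<Longrightarrow> P (Poly_Mapping.single w c + p)"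
  shows "P p"
proof (induction p rule: update_induct)
  case const
  then show ?case by (rule assms(1))
next
  case (update p w c)
  have "Poly_Mapping.update w c p = Poly_Mapping.single w c + p"
    using update.hyps
    by (intro poly_mapping_eqI) (auto simp: lookup_update lookup_add lookup_single when_def in_keys_iff)
  then show ?case using assms(2) update by simp
qed

definition free_eval :: "('g \<Rightarrow> 'k::field linop) \<Rightarrow> ('g, 'k) free_algebra \<Rightarrow> 'k linop"
  where "free_eval g p =
    (\<Sum>w\<in>Poly_Mapping.keys p. scal (Poly_Mapping.lookup p w) * prod_list (map g (letters w)))"

lemma free_eval_0 [simp]: "free_eval g 0 = 0"
  by (simp add: free_eval_def)

lemma free_eval_single [simp]:
  "free_eval g (Poly_Mapping.single w c) = scal c * prod_list (map g (letters w))"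
  by (cases "c = 0") (simp_all add: free_eval_def)

lemma free_eval_add: "free_eval g (p + r) = free_eval g p + free_eval g r"
  unfolding free_eval_def by (rule setsum_keys_plus_distrib) (simp_all add: scal_add distrib_right)

lemma free_eval_diff: "free_eval g (p - r) = free_eval g p - free_eval g r"
  using free_eval_add[of g "p - r" r] by simp

lemma free_eval_mult: "free_eval g (p * r) = free_eval g p * free_eval g r"
proof (induction p rule: poly_mapping_single_add_induct)
  case (single_add w c p)
  have "free_eval g (Poly_Mapping.single w c * r) = free_eval g (Poly_Mapping.single w c) * free_eval g r"
  proof (induction r rule: poly_mapping_single_add_induct)
    case (single_add v d r)
    \<comment> \<open>Scalars are central, so \<open>scal d\<close> can be moved across the word
      \<open>w\<close>.\<close>
    have "scal (c * d) * (prod_list (map g (letters w)) * prod_list (map g (letters v))) =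
      scal c * prod_list (map g (letters w)) * (scal d * prod_list (map g (letters v)))"
      by (metis (no_types, opaque_lifting) mult.assoc scal_comm scal_mult)
    then have "free_eval g (Poly_Mapping.single w c * Poly_Mapping.single v d) =
      free_eval g (Poly_Mapping.single w c) * free_eval g (Poly_Mapping.single v d)"
      by (simp add: mult_single plus_word_def)
    then show ?case
      by (simp only: distrib_left free_eval_add single_add)
  qed simp
  then show ?case
    by (simp only: distrib_right free_eval_add single_add)
qed simp

lemma free_eval_scalar [simp]: "free_eval g (free_scalar c) = scal c"
  by (simp add: free_scalar_def zero_word_def)

lemma free_eval_1 [simp]: "free_eval g 1 = 1"
  using free_eval_scalar[of g 1] by (simp add: free_scalar_def)

lemma free_eval_gen [simp]: "free_eval g (free_gen s) = g s"
  by (simp add: free_gen_def)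

lemma free_eval_power: "free_eval g (p ^ n) = free_eval g p ^ n"
  by (induction n) (simp_all add: free_eval_mult)

lemma free_eval_sum: "free_eval g (\<Sum>i\<in>A. f i) = (\<Sum>i\<in>A. free_eval g (f i))"
  by (induction A rule: infinite_finite_induct) (simp_all add: free_eval_add)

text \<open>Containing all scalar operators yields 0, 1 and, through products, closure under scalar
  multiplication.\<close>

definition subalgebra_op :: "'k::field linop set \<Rightarrow> bool"
  where "subalgebra_op S \<longleftrightarrow> range scal \<subseteq> S \<and> (\<forall>u\<in>S. \<forall>v\<in>S. u + v \<in> S \<and> u * v \<in> S)"

lemma subalgebra_opD:
  assumes "subalgebra_op S"
  shows "scal c \<in> S" "u \<in> S \<Longrightarrow> v \<in> S \<Longrightarrow> u + v \<in> S" "u \<in> S \<Longrightarrow> v \<in> S \<Longrightarrow> u * v \<in> S"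
    "0 \<in> S" "1 \<in> S"
  using assms scal_0[where 'a = 'a] scal_1[where 'a = 'a] unfolding subalgebra_op_def
  by (blast, blast, blast, metis rangeI subsetD, metis rangeI subsetD)

lemma subalgebra_op_range: "subalgebra_op (range (free_eval g))"
  unfolding subalgebra_op_def
  by (auto simp flip: free_eval_add free_eval_mult) (metis free_eval_scalar rangeI)

lemma gen_in_range: "g s \<in> range (free_eval g)"
  by (metis free_eval_gen rangeI)

text \<open>Together with \<open>subalgebra_op_range\<close> and \<open>gen_in_range\<close> this
  identifies the range as the subalgebra generated by the values of \<open>g\<close>.\<close>

lemma range_free_eval_subset:
  assumes "subalgebra_op S" and "range g \<subseteq> S"
  shows "range (free_eval g) \<subseteq> S"
proof (rule image_subsetI)
  fix p
  have "prod_list (map g l) \<in> S" for l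
    using assms by (induction l) (auto intro!: subalgebra_opD(3,5))
  then show "free_eval g p \<in> S"
    by (induction p rule: poly_mapping_single_add_induct)
      (auto simp: subalgebra_opD assms free_eval_add)
qed

section \<open>Presented algebras\<close>

lemma ring_of_type_algebra_simps [simp]:
  "carrier ring_of_type_algebra = UNIV" "monoid.mult ring_of_type_algebra = (*)"
  "one ring_of_type_algebra = 1" "ring.zero ring_of_type_algebra = 0"
  "add ring_of_type_algebra = (+)"
  by (simp_all add: ring_of_type_algebra_def fun_eq_iff)

lemma ring_ring_of_type_algebra: "ring (ring_of_type_algebra :: 'a::ring_1 ring)"
proof -
  have "\<exists>y. x + y = 0" for x :: 'a
    using add.right_inverse by blast
  then show ?thesis
    unfolding ring_of_type_algebra_def using add.right_inverse
    by unfold_locales (auto simp: algebra_simps Units_def)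
qed

text \<open>The first isomorphism theorem. A scalar acts on the quotient as multiplication by the
  class of \<open>free_scalar c\<close>, which evaluates to \<open>scal c\<close>, so linearity
  follows from multiplicativity.\<close>

lemma presented_algebra_iso:
  assumes "a_kernel free_ring ring_of_type_algebra (free_eval g) = Idl\<^bsub>free_ring\<^esub> R"
  shows "\<exists>\<Psi>. \<Psi> \<in> alg_iso (presented_algebra R) (op_algebra (range (free_eval g)))"
proof -
  let ?F = "free_ring :: ('a, 'b) free_algebra ring"
  let ?I = "Idl\<^bsub>?F\<^esub> R"
  let ?\<Psi> = "\<lambda>U. the_elem (free_eval g ` U)"
  interpret ring_hom_ring ?F ring_of_type_algebra "free_eval g"
    by (intro ring_hom_ringI ring_ring_of_type_algebra) (simp_all add: free_eval_add free_eval_mult)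
  note iso = FactRing_iso_set_aux[unfolded assms]
  have Psi_coset: "?\<Psi> (?I +>\<^bsub>?F\<^esub> p) = free_eval g p" for p
    using the_elem_simp[of p] by (simp add: assms)
  have coset: "?I +>\<^bsub>?F\<^esub> p \<in> carrier (?F Quot ?I)" for p
    by (auto simp: FactRing_def A_RCOSETS_def')
  have "?\<Psi> \<in> ring_iso (presented_algebra R) (op_algebra (range (free_eval g)))"
    using iso unfolding presented_algebra_def Let_def ring_iso_def ring_hom_def by simp
  moreover have "?\<Psi> (c \<odot>\<^bsub>presented_algebra R\<^esub> u) = c \<odot>\<^bsub>op_algebra (range (free_eval g))\<^esub> ?\<Psi> u"
    if "u \<in> carrier (presented_algebra R)" for c u
    using that ring_iso_memE(2)[OF iso coset, of u "free_scalar c"]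
    by (simp add: presented_algebra_def Let_def Psi_coset)
  ultimately show ?thesis
    unfolding alg_iso_def by blast
qed

text \<open>Supplies the closure premises of \<open>alg_iso_sym\<close> for a presented
  algebra.\<close>

lemma presented_algebra_closed:
  fixes R :: "('g, 'k::field) free_algebra set"
  shows "u \<in> carrier (presented_algebra R) \<Longrightarrow> v \<in> carrier (presented_algebra R) \<Longrightarrow>
      u \<otimes>\<^bsub>presented_algebra R\<^esub> v \<in> carrier (presented_algebra R)"
    "u \<in> carrier (presented_algebra R) \<Longrightarrow> v \<in> carrier (presented_algebra R) \<Longrightarrow>
      u \<oplus>\<^bsub>presented_algebra R\<^esub> v \<in> carrier (presented_algebra R)"
    "\<one>\<^bsub>presented_algebra R\<^esub> \<in> carrier (presented_algebra R)"
    "u \<in> carrier (presented_algebra R) \<Longrightarrow>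
      c \<odot>\<^bsub>presented_algebra R\<^esub> u \<in> carrier (presented_algebra R)"
proof -
  let ?F = "free_ring :: ('g, 'k) free_algebra ring"
  interpret F: ring ?F by (rule ring_ring_of_type_algebra)
  interpret I: ideal "Idl\<^bsub>?F\<^esub> R" ?F by (intro F.genideal_ideal) simp
  interpret Q: ring "?F Quot (Idl\<^bsub>?F\<^esub> R)" by (rule I.quotient_is_ring)
  have coset: "Idl\<^bsub>?F\<^esub> R +>\<^bsub>?F\<^esub> p \<in> carrier (?F Quot (Idl\<^bsub>?F\<^esub> R))" for p
    by (auto simp: FactRing_def A_RCOSETS_def')
  show "u \<in> carrier (presented_algebra R) \<Longrightarrow> v \<in> carrier (presented_algebra R) \<Longrightarrow>
      u \<otimes>\<^bsub>presented_algebra R\<^esub> v \<in> carrier (presented_algebra R)"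
    "u \<in> carrier (presented_algebra R) \<Longrightarrow> v \<in> carrier (presented_algebra R) \<Longrightarrow>
      u \<oplus>\<^bsub>presented_algebra R\<^esub> v \<in> carrier (presented_algebra R)"
    "\<one>\<^bsub>presented_algebra R\<^esub> \<in> carrier (presented_algebra R)"
    "u \<in> carrier (presented_algebra R) \<Longrightarrow>
      c \<odot>\<^bsub>presented_algebra R\<^esub> u \<in> carrier (presented_algebra R)"
    by (simp_all add: presented_algebra_def Let_def coset)
qed

section \<open>Weighted shifts\<close>

text \<open>The operator p(h) x^i, where x is the shift and h multiplies the entry at
  \<open>n\<close> by \<open>q powi n\<close>.\<close>

lift_definition wshift :: "'k::field \<Rightarrow> 'k poly \<Rightarrow> int \<Rightarrow> 'k linop"
  is "\<lambda>q p i u n. poly p (q powi n) * u (n + i)"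
  by (simp add: algebra_simps)

lemma app_linop_sum: "app_linop (\<Sum>i\<in>A. f i) u n = (\<Sum>i\<in>A. app_linop (f i) u n)"
  by (induction A rule: infinite_finite_induct) (simp_all add: zero_linop.rep_eq plus_linop.rep_eq)

locale skew_laurent =
  fixes q :: "'k::field"
  assumes q_nonzero: "q \<noteq> 0" and q_not_root_of_unity: "n > 0 \<Longrightarrow> q ^ n \<noteq> 1"
begin

abbreviation mn :: "'k poly \<Rightarrow> int \<Rightarrow> 'k linop" where "mn \<equiv> wshift q"

text \<open>The automorphism \<sigma>^i, which a coefficient undergoes when x^i is moved past
  it.\<close>

definition tw :: "int \<Rightarrow> 'k poly \<Rightarrow> 'k poly"
  where "tw i p = pcompose p [:0, q powi i:]"

lemma tw_mult: "tw i (p * r) = tw i p * tw i r"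
  by (simp add: tw_def pcompose_mult)

lemma tw_zero [simp]: "tw i 0 = 0"
  by (simp add: tw_def)

lemma tw_const [simp]: "tw i [:c:] = [:c:]"
  by (simp add: tw_def)

lemma tw_1 [simp]: "tw i 1 = 1"
  by (simp add: tw_def pcompose_1)

lemma tw_pCons: "tw i (pCons c p) = [:c:] + [:0, q powi i:] * tw i p"
  by (simp add: tw_def pcompose_pCons)

lemma tw_0 [simp]: "tw 0 p = p"
  by (simp add: tw_def pcompose_idR)

lemma degree_tw [simp]: "degree (tw i p) = degree p"
  by (simp add: tw_def degree_pcompose q_nonzero)

lemma tw_eq_0_iff [simp]: "tw i p = 0 \<longleftrightarrow> p = 0"
  unfolding tw_def by (rule pcompose_eq_0_iff) (simp add: q_nonzero)

lemma coeff_tw: "coeff (tw i p) j = (q powi i) ^ j * coeff p j"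
proof (induction p arbitrary: j)
  case 0
  then show ?case by (simp add: tw_def)
next
  case (pCons c p)
  then show ?case by (cases j) (simp_all add: tw_pCons)
qed

lemma tw_monom: "tw i (monom c j) = monom (c * (q powi i) ^ j) j"
  by (rule poly_eqI) (auto simp: coeff_tw)

lemma wshift_mult: "mn p i * mn r j = mn (p * tw i r) (i + j)"
  by (rule linop_eqI)
    (simp add: times_linop.rep_eq wshift.rep_eq tw_def poly_pcompose power_int_add q_nonzero algebra_simps)

lemma wshift_add: "mn (p + r) i = mn p i + mn r i"
  by (rule linop_eqI) (simp add: plus_linop.rep_eq wshift.rep_eq algebra_simps)

lemma wshift_0 [simp]: "mn 0 i = 0"
  by (rule linop_eqI) (simp add: zero_linop.rep_eq wshift.rep_eq)

lemma wshift_1 [simp]: "mn 1 0 = 1"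
  by (rule linop_eqI) (simp add: one_linop.rep_eq wshift.rep_eq)

lemma scal_eq_wshift: "scal c = mn [:c:] 0"
  by (rule linop_eqI) (simp add: scal.rep_eq wshift.rep_eq)

lemma scal_mult_wshift: "scal c * mn p i = mn (Polynomial.smult c p) i"
  by (simp add: scal_eq_wshift wshift_mult)

lemma wshift_power_0: "mn p 0 ^ n = mn (p ^ n) 0"
  by (induction n) (simp_all add: wshift_mult)

section \<open>Powers of \<open>q\<close> as evaluation points\<close>

lemma inj_q_power: "inj (\<lambda>n::nat. q ^ n)"
proof (rule linorder_injI)
  fix m n :: nat assume "m < n"
  then have "q ^ n = q ^ m * q ^ (n - m)" by (simp flip: power_add)
  then show "q ^ m \<noteq> q ^ n"
    using q_not_root_of_unity[of "n - m"] \<open>m < n\<close> q_nonzero by simp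
qed

text \<open>As \<open>q\<close> is not a root of unity, its powers are infinitely many points, more
  than a nonzero polynomial can have as roots.\<close>

lemma poly_eq_0_if_zero_on_powers:
  assumes "\<And>n. poly p (q powi n) = 0"
  shows "p = 0"
proof (rule ccontr)
  assume "p \<noteq> 0"
  then have "finite {x. poly p x = 0}" by (rule poly_roots_finite)
  moreover have "range (\<lambda>n::nat. q ^ n) \<subseteq> {x. poly p x = 0}"
    using assms by (auto simp flip: power_int_of_nat)
  ultimately show False
    using inj_q_power by (metis finite_subset range_inj_infinite)
qed

lemma q_powi_eq_iff: "q powi i = q powi j \<longleftrightarrow> i = j"
proof -
  have *: "i = j" if "q powi i = q powi j" "i \<le> j" for i j
  proof -
    have "q powi j = q powi i * q powi (j - i)"
      using q_nonzero by (simp flip: power_int_add)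
    then have "q powi (j - i) = 1"
      using that q_nonzero by simp
    then have "q ^ nat (j - i) = 1"
      using that by (simp add: power_int_def)
    then show "i = j"
      using q_not_root_of_unity[of "nat (j - i)"] that by (cases "i < j") auto
  qed
  show ?thesis
    using *[of i j] *[of j i] by force
qed

text \<open>A skew Laurent polynomial with coefficients on the left; \<open>F\<close> stores the
  coefficient of x^i at \<open>i\<close>.\<close>

definition lin :: "(int \<Rightarrow>\<^sub>0 'k poly) \<Rightarrow> 'k linop"
  where "lin F = (\<Sum>i\<in>Poly_Mapping.keys F. mn (Poly_Mapping.lookup F i) i)"

lemma lin_0 [simp]: "lin 0 = 0"
  by (simp add: lin_def)

lemma lin_single [simp]: "lin (Poly_Mapping.single i p) = mn p i"
  by (cases "p = 0") (simp_all add: lin_def)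

lemma lin_add: "lin (F + G) = lin F + lin G"
  unfolding lin_def by (rule setsum_keys_plus_distrib) (simp_all add: wshift_add)

lemma lin_sum: "lin (\<Sum>i\<in>A. f i) = (\<Sum>i\<in>A. lin (f i))"
  by (induction A rule: infinite_finite_induct) (simp_all add: lin_add)

lemma lin_mult:
  "lin F * lin G = lin (\<Sum>i\<in>Poly_Mapping.keys F. \<Sum>j\<in>Poly_Mapping.keys G.
    Poly_Mapping.single (i + j) (Poly_Mapping.lookup F i * tw i (Poly_Mapping.lookup G j)))"
  unfolding lin_sum lin_single wshift_mult[symmetric] by (simp add: lin_def sum_product)

text \<open>Probing with the unit sequence at \<open>n + k\<close> isolates the term of degree
  \<open>k\<close> and evaluates its coefficient at \<open>q powi n\<close>. Over all
  \<open>n\<close> these values determine the coefficient, which makes \<open>lin\<close>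
  injective.\<close>

lemma app_lin_delta:
  "app_linop (lin F) (\<lambda>m. if m = n + k then 1 else 0) n = poly (Poly_Mapping.lookup F k) (q powi n)"
proof -
  have "app_linop (lin F) (\<lambda>m. if m = n + k then 1 else 0) n =
    (\<Sum>i\<in>Poly_Mapping.keys F. if i = k then poly (Poly_Mapping.lookup F i) (q powi n) else 0)"
    unfolding lin_def app_linop_sum by (rule sum.cong) (simp_all add: wshift.rep_eq)
  then show ?thesis
    by (simp add: sum.delta in_keys_iff)
qed

lemma lin_inject: "lin F = lin G \<longleftrightarrow> F = G"
proof
  assume eq: "lin F = lin G"
  show "F = G"
  proof (rule poly_mapping_eqI)
    fix k
    have "poly (Poly_Mapping.lookup F k - Poly_Mapping.lookup G k) (q powi n) = 0" for n
      using app_lin_delta[of F n k] app_lin_delta[of G n k] eq by simp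
    then show "Poly_Mapping.lookup F k = Poly_Mapping.lookup G k"
      using poly_eq_0_if_zero_on_powers eq_iff_diff_eq_0 by blast
  qed
qed simp

lemma wshift_inject: "mn p i = mn r j \<longleftrightarrow> p = r \<and> (i = j \<or> p = 0)"
proof -
  have "mn p i = mn r j \<longleftrightarrow> Poly_Mapping.single i p = Poly_Mapping.single j r"
    by (simp flip: lin_single add: lin_inject)
  also have "\<dots> \<longleftrightarrow> p = r \<and> (i = j \<or> p = 0)"
    by (metis lookup_single_eq lookup_single_not_eq single_zero)
  finally show ?thesis .
qed

lemma wshift_eq_0_iff [simp]: "mn p i = 0 \<longleftrightarrow> p = 0"
  using wshift_inject[of p i 0 i] by simp

text \<open>A degree that arises from only one pair of support points admits no cancellation, and
  the product of the two coefficients is nonzero since polynomials over a field form a domain and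
  the twist is injective.\<close>

lemma lookup_lin_mult_extreme:
  assumes "lin F * lin G = lin K"
    and "i \<in> Poly_Mapping.keys F" and "j \<in> Poly_Mapping.keys G"
    and uniq: "\<And>i' j'. i' \<in> Poly_Mapping.keys F \<Longrightarrow> j' \<in> Poly_Mapping.keys G \<Longrightarrow>
      i' + j' = i + j \<Longrightarrow> i' = i"
  shows "i + j \<in> Poly_Mapping.keys K"
proof -
  let ?c = "\<lambda>i j. Poly_Mapping.lookup F i * tw i (Poly_Mapping.lookup G j)"
  have "K = (\<Sum>i\<in>Poly_Mapping.keys F. \<Sum>j\<in>Poly_Mapping.keys G. Poly_Mapping.single (i + j) (?c i j))"
    using assms(1) by (simp only: lin_mult lin_inject)
  then have "Poly_Mapping.lookup K (i + j) = (\<Sum>i'\<in>Poly_Mapping.keys F. \<Sum>j'\<in>Poly_Mapping.keys G.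
      if i' + j' = i + j then ?c i' j' else 0)"
    by (simp add: lookup_sum lookup_single when_def)
  also have "\<dots> = (\<Sum>i'\<in>Poly_Mapping.keys F. \<Sum>j'\<in>Poly_Mapping.keys G.
      if i' = i then if j' = j then ?c i j else 0 else 0)"
  proof (intro sum.cong refl)
    fix i' j' assume "i' \<in> Poly_Mapping.keys F" "j' \<in> Poly_Mapping.keys G"
    then show "(if i' + j' = i + j then ?c i' j' else 0) =
        (if i' = i then if j' = j then ?c i j else 0 else 0)"
      using uniq[of i' j'] by auto
  qed
  also have "\<dots> = (\<Sum>i'\<in>Poly_Mapping.keys F. if i' = i then ?c i j else 0)"
    using assms(3) by (intro sum.cong refl) simp
  also have "\<dots> = ?c i j"
    using assms(2) by simp
  finally show ?thesis
    using assms(2,3) by (simp add: in_keys_iff)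
qed

text \<open>Right multiplication by a homogeneous element of degree \<open>d\<close> shifts the
  support of \<open>F\<close> by \<open>d\<close>. Comparing largest degrees shows that
  \<open>G\<close> has no degree above \<open>d\<close>, comparing smallest degrees that it has none
  below.\<close>

lemma homogeneous_if_skew_commute:
  assumes "lin F \<noteq> 0" and eq: "lin F * mn r d = lin G * lin F"
  shows "\<exists>g. lin G = mn g d"
proof (cases "G = 0")
  case True
  then show ?thesis by (metis lin_0 wshift_0)
next
  case False
  let ?kF = "Poly_Mapping.keys F" and ?kG = "Poly_Mapping.keys G"
  have neF: "?kF \<noteq> {}" and neG: "?kG \<noteq> {}"
    using assms(1) False by auto
  define K where "K = (\<Sum>i\<in>?kF.
    Poly_Mapping.single (i + d) (Poly_Mapping.lookup F i * tw i r))"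
  have "lin F * mn r d = lin K"
    unfolding K_def lin_sum lin_single wshift_mult[symmetric] by (simp add: lin_def sum_distrib_right)
  then have K: "lin G * lin F = lin K" using eq by simp
  have keysK: "k - d \<in> ?kF" if "k \<in> Poly_Mapping.keys K" for k
  proof (rule ccontr)
    assume "k - d \<notin> ?kF"
    then have ne: "i + d \<noteq> k" if "i \<in> ?kF" for i using that by auto
    have "Poly_Mapping.lookup K k = 0"
      unfolding K_def lookup_sum by (rule sum.neutral) (simp add: lookup_single_not_eq ne)
    then show False using that by (simp add: in_keys_iff)
  qed
  have "Max ?kG + Max ?kF \<in> Poly_Mapping.keys K"
  proof (rule lookup_lin_mult_extreme[OF K])
    fix i j assume "i \<in> ?kG" "j \<in> ?kF" "i + j = Max ?kG + Max ?kF"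
    then show "i = Max ?kG"
      using Max_ge[OF finite_keys, of i G] Max_ge[OF finite_keys, of j F] by linarith
  qed (use neF neG in auto)
  then have "Max ?kG + Max ?kF - d \<le> Max ?kF"
    by (intro Max_ge keysK) simp_all
  moreover have "Min ?kG + Min ?kF \<in> Poly_Mapping.keys K"
  proof (rule lookup_lin_mult_extreme[OF K])
    fix i j assume "i \<in> ?kG" "j \<in> ?kF" "i + j = Min ?kG + Min ?kF"
    then show "i = Min ?kG"
      using Min_le[OF finite_keys, of i G] Min_le[OF finite_keys, of j F] by linarith
  qed (use neF neG in auto)
  then have "Min ?kF \<le> Min ?kG + Min ?kF - d"
    by (intro Min_le keysK) simp_all
  ultimately have "i = d" if "i \<in> ?kG" for i
    using Max_ge[OF finite_keys, of i G] Min_le[OF finite_keys, of i G] that by linarith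
  then have "?kG = {d}" using neG by blast
  then show ?thesis by (auto simp: lin_def)
qed

text \<open>In each degree \<open>k\<close> of the support, cancelling the nonzero coefficient
  leaves p = q^k h. The powers of \<open>q\<close> are distinct, so the support is a single
  point.\<close>

lemma homogeneous_if_commute_h:
  assumes "lin F * mn [:0, 1:] 0 = mn p 0 * lin F" and "lin F \<noteq> 0"
  shows "\<exists>f i. lin F = mn f i \<and> p = [:0, q powi i:]"
proof -
  have "lin F * mn [:0, 1:] 0 = lin (\<Sum>i\<in>Poly_Mapping.keys F.
    Poly_Mapping.single i (Poly_Mapping.lookup F i * [:0, q powi i:]))"
    unfolding lin_sum lin_single by (simp add: lin_def sum_distrib_right wshift_mult tw_pCons)
  moreover have "mn p 0 * lin F = lin (\<Sum>i\<in>Poly_Mapping.keys F.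
    Poly_Mapping.single i (p * Poly_Mapping.lookup F i))"
    unfolding lin_sum lin_single by (simp add: lin_def sum_distrib_left wshift_mult)
  ultimately have eq: "(\<Sum>i\<in>Poly_Mapping.keys F.
      Poly_Mapping.single i (Poly_Mapping.lookup F i * [:0, q powi i:])) =
    (\<Sum>i\<in>Poly_Mapping.keys F. Poly_Mapping.single i (p * Poly_Mapping.lookup F i))"
    using assms(1) lin_inject by metis
  have p: "p = [:0, q powi k:]" if "k \<in> Poly_Mapping.keys F" for k
  proof -
    have "Poly_Mapping.lookup F k * [:0, q powi k:] = Poly_Mapping.lookup F k * p"
      using arg_cong[OF eq, of "\<lambda>f. Poly_Mapping.lookup f k"] that
      by (simp add: lookup_sum lookup_single when_def mult.commute)
    then show ?thesis
      using that unfolding mult_cancel_left in_keys_iff by simp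
  qed
  obtain k where k: "k \<in> Poly_Mapping.keys F"
    using assms(2) by fastforce
  have "i = k" if "i \<in> Poly_Mapping.keys F" for i
    using p[OF that] p[OF k] q_powi_eq_iff by simp
  then have "Poly_Mapping.keys F = {k}"
    using k by blast
  then have "lin F = mn (Poly_Mapping.lookup F k) k"
    by (simp add: lin_def)
  then show ?thesis using p k by blast
qed

end

section \<open>Polynomials in the free algebra\<close>

lemma free_scalar_comm:
  fixes u :: "('g, 'k::comm_ring_1) free_algebra"
  shows "u * free_scalar c = free_scalar c * u"
  by (induction u rule: poly_mapping_single_add_induct)
    (simp_all add: free_scalar_def mult_single distrib_left distrib_right mult.commute)

lemma free_scalar_add: "free_scalar (c + d) = free_scalar c + free_scalar d"
  by (simp add: free_scalar_def single_add)

lemma free_scalar_mult: "free_scalar (c * d) = free_scalar c * free_scalar d"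
  by (simp add: free_scalar_def mult_single)

lemma free_scalar_0 [simp]: "free_scalar 0 = 0"
  by (simp add: free_scalar_def)

lemma free_scalar_1 [simp]: "free_scalar 1 = 1"
  by (simp add: free_scalar_def)

lemma free_poly_altdef:
  "degree p \<le> n \<Longrightarrow> free_poly p u = (\<Sum>i\<le>n. free_scalar (coeff p i) * u ^ i)"
  unfolding free_poly_def by (rule sum.mono_neutral_left) (auto simp: coeff_eq_0)

lemma free_poly_0 [simp]: "free_poly 0 u = 0"
  by (simp add: free_poly_def)

lemma free_poly_add: "free_poly (p + r) u = free_poly p u + free_poly r u"
proof -
  let ?n = "max (degree p) (degree r)"
  have "free_poly (p + r) u = (\<Sum>i\<le>?n. free_scalar (coeff (p + r) i) * u ^ i)"
    by (rule free_poly_altdef) (rule degree_add_le_max)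
  also have "\<dots> = (\<Sum>i\<le>?n. free_scalar (coeff p i) * u ^ i) + (\<Sum>i\<le>?n. free_scalar (coeff r i) * u ^ i)"
    by (simp add: free_scalar_add distrib_right sum.distrib)
  also have "\<dots> = free_poly p u + free_poly r u"
    using free_poly_altdef[of p ?n u] free_poly_altdef[of r ?n u] by simp
  finally show ?thesis .
qed

lemma free_poly_pCons: "free_poly (pCons c p) u = free_scalar c + u * free_poly p u"
proof -
  have "free_poly (pCons c p) u =
      (\<Sum>i\<le>Suc (degree p). free_scalar (coeff (pCons c p) i) * u ^ i)"
    by (rule free_poly_altdef) (rule degree_pCons_le)
  also have "\<dots> = free_scalar c + (\<Sum>i\<le>degree p. free_scalar (coeff p i) * u ^ Suc i)"
    by (simp only: sum.atMost_Suc_shift coeff_pCons_0 coeff_pCons_Suc power_0 mult_1_right)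
  also have "(\<Sum>i\<le>degree p. free_scalar (coeff p i) * u ^ Suc i) = u * free_poly p u"
    unfolding free_poly_def sum_distrib_left
    by (rule sum.cong) (simp_all add: free_scalar_comm flip: mult.assoc)
  finally show ?thesis .
qed

lemma free_poly_smult: "free_poly (Polynomial.smult c p) u = free_scalar c * free_poly p u"
proof (induction p)
  case (pCons d p)
  have "u * (free_scalar c * free_poly p u) = free_scalar c * (u * free_poly p u)"
    by (simp add: free_scalar_comm flip: mult.assoc)
  then show ?case
    by (simp add: free_poly_pCons pCons distrib_left free_scalar_mult)
qed simp

lemma free_poly_mult: "free_poly (p * r) u = free_poly p u * free_poly r u"
  by (induction p)
    (simp_all add: mult_pCons_left free_poly_add free_poly_smult free_poly_pCons distrib_right mult.assoc)

lemma ideal_of_type_algebraD: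
  assumes "ideal I (ring_of_type_algebra :: 'a::ring_1 ring)"
  shows "0 \<in> I" "u \<in> I \<Longrightarrow> v \<in> I \<Longrightarrow> u + v \<in> I" "u \<in> I \<Longrightarrow> v \<in> I \<Longrightarrow> u - v \<in> I"
    "u \<in> I \<Longrightarrow> c * u \<in> I" "u \<in> I \<Longrightarrow> u * c \<in> I"
proof -
  interpret ideal I "ring_of_type_algebra :: 'a ring" by fact
  show l: "u \<in> I \<Longrightarrow> c * u \<in> I" for u c using I_l_closed[of u c] by simp
  show "u \<in> I \<Longrightarrow> u * c \<in> I" using I_r_closed[of u c] by simp
  show "0 \<in> I" using additive_subgroup.zero_closed[OF is_additive_subgroup] by simp
  show add: "u \<in> I \<Longrightarrow> v \<in> I \<Longrightarrow> u + v \<in> I" for u v using additive_subgroup.a_closed[OF is_additive_subgroup, of u v] by simp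
  show "u \<in> I \<Longrightarrow> v \<in> I \<Longrightarrow> u - v \<in> I" using add[of u "- v"] l[of v "-1"] by simp
qed

section \<open>Normal forms in a generalized Weyl algebra\<close>

abbreviation free_h :: "(gwa_gen, 'k::comm_ring_1) free_algebra" where "free_h \<equiv> free_gen Gen_h"
abbreviation free_x :: "(gwa_gen, 'k::comm_ring_1) free_algebra" where "free_x \<equiv> free_gen Gen_x"
abbreviation free_y :: "(gwa_gen, 'k::comm_ring_1) free_algebra" where "free_y \<equiv> free_gen Gen_y"

text \<open>One power of a generator for each integer degree; the representation sends it to x^i up
  to a left coefficient.\<close>

definition xy_power :: "int \<Rightarrow> (gwa_gen, 'k::comm_ring_1) free_algebra"
  where "xy_power i = (if i \<ge> 0 then free_x ^ nat i else free_y ^ nat (- i))"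

definition normal_form :: "(int \<Rightarrow>\<^sub>0 'k::comm_ring_1 poly) \<Rightarrow> (gwa_gen, 'k) free_algebra"
  where "normal_form F =
    (\<Sum>i\<in>Poly_Mapping.keys F. free_poly (Poly_Mapping.lookup F i) free_h * xy_power i)"

lemma normal_form_0 [simp]: "normal_form 0 = 0"
  by (simp add: normal_form_def)

lemma normal_form_single [simp]:
  "normal_form (Poly_Mapping.single i p) = free_poly p free_h * xy_power i"
  by (cases "p = 0") (simp_all add: normal_form_def)

lemma normal_form_add: "normal_form (F + G) = normal_form F + normal_form G"
  unfolding normal_form_def
  by (rule setsum_keys_plus_distrib) (simp_all add: free_poly_add distrib_right)

context skew_laurent
begin

text \<open>The set \<open>gwa_relations\<close> for \<sigma>(h) = q h, with \<open>tw 1\<close> in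
  place of \<sigma>.\<close>

definition gwa_rels :: "'k poly \<Rightarrow> (gwa_gen, 'k) free_algebra set"
  where "gwa_rels a =
    {free_x * free_h - free_poly [:0, q:] free_h * free_x,
     free_y * free_h - free_poly [:0, inverse q:] free_h * free_y,
     free_x * free_y - free_poly (tw 1 a) free_h,
     free_y * free_x - free_poly a free_h}"

end

text \<open>Here normal forms are shown to span modulo the relations; their independence comes later
  from the representation.\<close>

locale gwa_ideal = skew_laurent q for q :: "'k::field" +
  fixes a :: "'k poly" and I :: "(gwa_gen, 'k) free_algebra set"
  assumes ideal: "ideal I free_ring" and rels: "gwa_rels a \<subseteq> I"
begin

lemmas idl = ideal_of_type_algebraD[OF ideal]

definition NF :: "(gwa_gen, 'k) free_algebra set"
  where "NF = {p. \<exists>F. p - normal_form F \<in> I}"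

lemma NF_cong: "u - v \<in> I \<Longrightarrow> v \<in> NF \<Longrightarrow> u \<in> NF"
  unfolding NF_def using idl(2)[of "u - v" "v - w" for w] by fastforce

lemma NF_add: "u \<in> NF \<Longrightarrow> v \<in> NF \<Longrightarrow> u + v \<in> NF"
proof -
  assume "u \<in> NF" "v \<in> NF"
  then obtain F G where "u - normal_form F \<in> I" "v - normal_form G \<in> I"
    unfolding NF_def by blast
  then have "(u + v) - normal_form (F + G) \<in> I"
    using idl(2)[of "u - normal_form F" "v - normal_form G"] by (simp add: normal_form_add algebra_simps)
  then show ?thesis unfolding NF_def by blast
qed

lemma NF_monomial: "free_poly p free_h * xy_power i \<in> NF"
  unfolding NF_def using idl(1) normal_form_single[of i p] by (metis (mono_tags) diff_self mem_Collect_eq)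

lemma NF_sum: "(\<And>i. i \<in> A \<Longrightarrow> f i \<in> NF) \<Longrightarrow> (\<Sum>i\<in>A. f i) \<in> NF"
  using NF_monomial[of 0 0] by (induction A rule: infinite_finite_induct) (auto intro: NF_add)

text \<open>Induction along Horner's scheme: the error splits into the assumed relation times the
  tail of \<open>p\<close>, plus c h times the error for the tail.\<close>

lemma move_past_poly:
  assumes "z * free_h - free_poly [:0, c:] free_h * z \<in> I"
  shows "z * free_poly p free_h - free_poly (pcompose p [:0, c:]) free_h * z \<in> I"
proof (induction p)
  case 0
  then show ?case using idl(1) by simp
next
  case (pCons d p)
  let ?p = "free_poly p free_h" and ?p' = "free_poly (pcompose p [:0, c:]) free_h"
    and ?c = "free_poly [:0, c:] free_h"
  have "z * free_poly (pCons d p) free_h - free_poly (pcompose (pCons d p) [:0, c:]) free_h * z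
      = (z * free_h - ?c * z) * ?p + ?c * (z * ?p - ?p' * z)"
    by (simp add: free_poly_pCons[of d p] pcompose_pCons free_poly_add free_poly_mult
        free_poly_pCons[of d 0] free_scalar_comm[of z d] algebra_simps del: mult_pCons_left)
  then show ?case
    using idl(2)[OF idl(5)[OF assms] idl(4)[OF pCons.IH]] by simp
qed

text \<open>For nonnegative \<open>i\<close> the power just grows; for negative \<open>i\<close> the
  new x meets a y and both are absorbed by x y = \<sigma>(a).\<close>

lemma x_xy_power: "\<exists>b. free_x * xy_power i - free_poly b free_h * xy_power (i + 1) \<in> I"
proof (cases "i \<ge> 0")
  case True
  then have "free_x * xy_power i - free_poly 1 free_h * xy_power (i + 1) = 0"
    by (simp add: xy_power_def nat_add_distrib free_poly_def)
  then show ?thesis using idl(1) by metis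
next
  case False
  \<comment> \<open>The exponent that remains after one factor y has been split off.\<close>
  define m where "m = nat (- i) - 1"
  have "xy_power i = (free_y * free_y ^ m :: (gwa_gen, 'k) free_algebra)"
    "xy_power (i + 1) = (free_y ^ m :: (gwa_gen, 'k) free_algebra)"
    using False by (auto simp: xy_power_def m_def power_eq_if nat_diff_distrib Suc_diff_Suc simp flip: power_Suc)
  then have "free_x * xy_power i - free_poly (tw 1 a) free_h * xy_power (i + 1)
      = (free_x * free_y - free_poly (tw 1 a) free_h) * free_y ^ m"
    by (simp only: left_diff_distrib mult.assoc)
  then show ?thesis
    using idl(5) rels unfolding gwa_rels_def by (metis insert_subset)
qed

lemma y_xy_power: "\<exists>b. free_y * xy_power i - free_poly b free_h * xy_power (i - 1) \<in> I"
proof (cases "i \<le> 0")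
  case True
  then have "nat (1 - i) = Suc (nat (- i))" by simp
  then have "free_y * xy_power i - free_poly 1 free_h * xy_power (i - 1) = 0"
    using True by (auto simp: xy_power_def free_poly_def)
  then show ?thesis using idl(1) by metis
next
  case False
  define m where "m = nat i - 1"
  have "xy_power i = (free_x * free_x ^ m :: (gwa_gen, 'k) free_algebra)"
    "xy_power (i - 1) = (free_x ^ m :: (gwa_gen, 'k) free_algebra)"
    using False by (auto simp: xy_power_def m_def power_eq_if nat_diff_distrib Suc_diff_Suc simp flip: power_Suc)
  then have "free_y * xy_power i - free_poly a free_h * xy_power (i - 1)
      = (free_y * free_x - free_poly a free_h) * free_x ^ m"
    by (simp only: left_diff_distrib mult.assoc)
  then show ?thesis
    using idl(5) rels unfolding gwa_rels_def by (metis insert_subset)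
qed

text \<open>A generator first passes the coefficient and is then absorbed by the power.
  \<open>step\<close> does this for x and y alike, while h merely multiplies the
  coefficient.\<close>

lemma NF_gen_monomial: "free_gen s * (free_poly p free_h * xy_power i) \<in> NF"
proof -
  have step: "z * (free_poly p free_h * xy_power i) \<in> NF"
    if z: "z * free_h - free_poly [:0, c:] free_h * z \<in> I"
      and b: "z * xy_power i - free_poly b free_h * xy_power j \<in> I" for z c b j
  proof (rule NF_cong)
    let ?p = "free_poly p free_h" and ?p' = "free_poly (pcompose p [:0, c:]) free_h"
    have "z * (?p * xy_power i) - free_poly (pcompose p [:0, c:] * b) free_h * xy_power j
        = (z * ?p - ?p' * z) * xy_power i + ?p' * (z * xy_power i - free_poly b free_h * xy_power j)"
      by (simp add: free_poly_mult left_diff_distrib right_diff_distrib mult.assoc)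
    then show "z * (?p * xy_power i) - free_poly (pcompose p [:0, c:] * b) free_h * xy_power j \<in> I"
      using idl(2)[OF idl(5)[OF move_past_poly[OF z]] idl(4)[OF b]] by simp
    show "free_poly (pcompose p [:0, c:] * b) free_h * xy_power j \<in> NF"
      by (rule NF_monomial)
  qed
  show ?thesis
  proof (cases s)
    case Gen_h
    then show ?thesis
      using NF_monomial[of "pCons 0 p" i] by (simp add: free_poly_pCons mult.assoc)
  next
    case Gen_x
    then show ?thesis
      using step[of free_x q] x_xy_power rels unfolding gwa_rels_def by blast
  next
    case Gen_y
    then show ?thesis
      using step[of free_y "inverse q"] y_xy_power rels unfolding gwa_rels_def by blast
  qed
qed

lemma NF_mult:
  assumes "\<And>p i. g * (free_poly p free_h * xy_power i) \<in> NF" and "u \<in> NF"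
  shows "g * u \<in> NF"
proof -
  obtain F where F: "u - normal_form F \<in> I"
    using assms(2) unfolding NF_def by blast
  have "g * u - g * normal_form F \<in> I"
    using idl(4)[OF F, of g] by (simp add: right_diff_distrib)
  moreover have "g * normal_form F \<in> NF"
    unfolding normal_form_def sum_distrib_left by (intro NF_sum assms(1))
  ultimately show ?thesis by (rule NF_cong)
qed

text \<open>Words are normalized from their right end, each further letter multiplying a normal form
  from the left; linear combinations follow.\<close>

lemma normal_form_exists: "\<exists>F. p - normal_form F \<in> I"
proof -
  have word: "Poly_Mapping.single (Word l) 1 \<in> NF" for l :: "gwa_gen list"
  proof (induction l)
    case Nil
    have "free_poly 1 free_h * xy_power 0 = (Poly_Mapping.single (Word []) 1 :: (gwa_gen, 'k) free_algebra)"
      by (simp add: free_poly_def xy_power_def flip: zero_word_def)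
    then show ?case using NF_monomial by metis
  next
    case (Cons s l)
    have "Poly_Mapping.single (Word (s # l)) 1
        = (free_gen s * Poly_Mapping.single (Word l) 1 :: (gwa_gen, 'k) free_algebra)"
      by (simp add: free_gen_def mult_single plus_word_def)
    then show ?case using NF_mult[OF NF_gen_monomial Cons] by metis
  qed
  have "p \<in> NF"
  proof (induction p rule: poly_mapping_single_add_induct)
    case zero
    then show ?case using NF_monomial[of 0 0] by simp
  next
    case (single_add w c p)
    have "free_scalar c * (free_poly r free_h * xy_power i) \<in> NF" for r i
      using NF_monomial[of "Polynomial.smult c r" i] by (simp add: free_poly_smult mult.assoc)
    from NF_mult[OF this word] have "free_scalar c * Poly_Mapping.single w 1 \<in> NF"
      by (metis word.exhaust)
    then have "Poly_Mapping.single w c \<in> NF"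
      by (simp add: free_scalar_def mult_single)
    then show ?case using single_add by (rule NF_add)
  qed
  then show ?thesis unfolding NF_def by blast
qed

end

section \<open>The faithful representation of a generalized Weyl algebra\<close>

lemma mem_kernel_free_eval:
  "p \<in> a_kernel free_ring ring_of_type_algebra (free_eval g) \<longleftrightarrow> free_eval g p = 0"
  by (simp add: a_kernel_def')

context skew_laurent
begin

text \<open>The extra parameter \<open>l\<close> rescales \<open>h\<close>. Every \<open>l \<noteq> 0\<close> gives a faithful representation of the same
  algebra, so two algebras are isomorphic as soon as suitable parameters give the same image.\<close>

definition gwa_gens :: "'k \<Rightarrow> 'k poly \<Rightarrow> gwa_gen \<Rightarrow> 'k linop"
  where "gwa_gens l a s = (case s of
    Gen_h \<Rightarrow> mn [:0, l:] 0 | Gen_x \<Rightarrow> mn 1 1 | Gen_y \<Rightarrow> mn (pcompose a [:0, l:]) (-1))"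

lemma gwa_gens_simps [simp]:
  "gwa_gens l a Gen_h = mn [:0, l:] 0" "gwa_gens l a Gen_x = mn 1 1"
  "gwa_gens l a Gen_y = mn (pcompose a [:0, l:]) (-1)"
  by (simp_all add: gwa_gens_def)

lemma eval_free_poly:
  "free_eval (gwa_gens l a) (free_poly p free_h) = mn (pcompose p [:0, l:]) 0"
proof (induction p)
  case (pCons c p)
  then show ?case
    by (simp only: free_poly_pCons free_eval_add free_eval_scalar free_eval_mult free_eval_gen
        gwa_gens_simps wshift_mult wshift_add pcompose_pCons scal_eq_wshift tw_0 add_0)
qed simp

text \<open>The coefficient of (a(h) x^-1)^m, namely a(h) a(q^-1 h) ... a(q^(1-m) h).\<close>

fun y_coeff :: "'k poly \<Rightarrow> nat \<Rightarrow> 'k poly"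
  where "y_coeff a 0 = 1" | "y_coeff a (Suc m) = a * tw (-1) (y_coeff a m)"

lemma y_coeff_nonzero: "a \<noteq> 0 \<Longrightarrow> y_coeff a m \<noteq> 0"
  by (induction m) simp_all

lemma degree_y_coeff: "a \<noteq> 0 \<Longrightarrow> degree (y_coeff a m) = m * degree a"
  by (induction m) (simp_all add: degree_mult_eq y_coeff_nonzero)

definition xy_coeff :: "'k poly \<Rightarrow> int \<Rightarrow> 'k poly"
  where "xy_coeff a i = (if i \<ge> 0 then 1 else y_coeff a (nat (- i)))"

lemma xy_coeff_nonzero: "a \<noteq> 0 \<Longrightarrow> xy_coeff a i \<noteq> 0"
  by (simp add: xy_coeff_def y_coeff_nonzero)

lemma wshift_1_power: "mn 1 1 ^ m = mn 1 (int m)"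
  by (induction m) (simp_all add: wshift_mult)

lemma wshift_minus_1_power: "mn a (-1) ^ m = mn (y_coeff a m) (- int m)"
  by (induction m) (simp_all add: wshift_mult)

lemma eval_xy_power:
  "free_eval (gwa_gens l a) (xy_power i) = mn (xy_coeff (pcompose a [:0, l:]) i) i"
  by (simp add: xy_power_def xy_coeff_def free_eval_power wshift_1_power wshift_minus_1_power)

lemma eval_normal_form:
  "free_eval (gwa_gens l a) (normal_form F) = lin (\<Sum>i\<in>Poly_Mapping.keys F.
    Poly_Mapping.single i (pcompose (Poly_Mapping.lookup F i) [:0, l:] * xy_coeff (pcompose a [:0, l:]) i))"
  unfolding normal_form_def free_eval_sum free_eval_mult eval_free_poly eval_xy_power lin_sum lin_single
  by (simp add: wshift_mult)

lemma eval_rels: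
  assumes "p \<in> gwa_rels a"
  shows "free_eval (gwa_gens l a) p = 0"
proof -
  \<comment> \<open>Twisting and rescaling are both dilations of h and therefore commute.\<close>
  have "pcompose (tw 1 a) [:0, l:] = pcompose a (pcompose [:0, q:] [:0, l:])"
    "tw 1 (pcompose a [:0, l:]) = pcompose a (pcompose [:0, l:] [:0, q:])"
    by (simp_all add: tw_def pcompose_assoc)
  then have "pcompose (tw 1 a) [:0, l:] = tw 1 (pcompose a [:0, l:])"
    by (simp add: pcompose_pCons mult.commute)
  then show ?thesis
    using assms unfolding gwa_rels_def
    by (elim insertE emptyE)
      (simp_all add: free_eval_diff free_eval_mult eval_free_poly wshift_mult tw_pCons pcompose_pCons
        mult.commute[of l])
qed

text \<open>Modulo the ideal every element is a normal form. Its image has coefficients p_i(l h)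
  times a nonzero polynomial, so if the image vanishes, injectivity of \<open>lin\<close> forces all
  p_i to vanish.\<close>

lemma gwa_kernel:
  assumes "a \<noteq> 0" and "l \<noteq> 0"
  shows "a_kernel free_ring ring_of_type_algebra (free_eval (gwa_gens l a)) = Idl\<^bsub>free_ring\<^esub> (gwa_rels a)"
proof -
  let ?F = "free_ring :: (gwa_gen, 'k) free_algebra ring"
  let ?ev = "free_eval (gwa_gens l a)"
  interpret ring_hom_ring ?F ring_of_type_algebra ?ev
    by (intro ring_hom_ringI ring_ring_of_type_algebra) (simp_all add: free_eval_add free_eval_mult)
  have sub: "Idl\<^bsub>?F\<^esub> (gwa_rels a) \<subseteq> a_kernel ?F ring_of_type_algebra ?ev"
    by (intro R.genideal_minimal kernel_is_ideal subsetI) (simp add: mem_kernel_free_eval eval_rels)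
  interpret gwa_ideal q a "Idl\<^bsub>?F\<^esub> (gwa_rels a)"
    by (intro gwa_ideal.intro gwa_ideal_axioms.intro skew_laurent_axioms R.genideal_ideal R.genideal_self) simp_all
  have "p \<in> Idl\<^bsub>?F\<^esub> (gwa_rels a)" if "?ev p = 0" for p
  proof -
    obtain F where F: "p - normal_form F \<in> Idl\<^bsub>?F\<^esub> (gwa_rels a)"
      using normal_form_exists by blast
    then have "?ev (p - normal_form F) = 0"
      using sub mem_kernel_free_eval by blast
    then have "lin (\<Sum>i\<in>Poly_Mapping.keys F. Poly_Mapping.single i
        (pcompose (Poly_Mapping.lookup F i) [:0, l:] * xy_coeff (pcompose a [:0, l:]) i)) = lin 0"
      using that by (simp add: free_eval_diff eval_normal_form)
    then have eq: "(\<Sum>i\<in>Poly_Mapping.keys F. Poly_Mapping.single i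
        (pcompose (Poly_Mapping.lookup F i) [:0, l:] * xy_coeff (pcompose a [:0, l:]) i)) = 0"
      by (simp only: lin_inject)
    have nz: "pcompose r [:0, l:] \<noteq> 0" if "r \<noteq> 0" for r :: "'k poly"
      using that assms(2) by (subst pcompose_eq_0_iff) simp_all
    have "k \<notin> Poly_Mapping.keys F" for k
    proof
      assume k: "k \<in> Poly_Mapping.keys F"
      have "pcompose (Poly_Mapping.lookup F k) [:0, l:] * xy_coeff (pcompose a [:0, l:]) k = 0"
        using arg_cong[OF eq, of "\<lambda>f. Poly_Mapping.lookup f k"] k
        by (simp add: lookup_sum lookup_single when_def)
      then show False
        using k nz xy_coeff_nonzero[OF nz[OF assms(1)]] by (simp add: in_keys_iff)
    qed
    then have "F = 0" by (metis keys_eq_empty equals0I)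
    then show ?thesis using F by simp
  qed
  then show ?thesis using sub mem_kernel_free_eval by blast
qed

section \<open>The image of the representation as a concrete operator algebra\<close>

definition gwa_op :: "'k poly \<Rightarrow> 'k linop set"
  where "gwa_op a = range (free_eval (gwa_gens 1 a))"

lemma subalgebra_gwa_op: "subalgebra_op (gwa_op a)"
  by (simp add: gwa_op_def subalgebra_op_range)

lemmas gwa_op_closed = subalgebra_opD[OF subalgebra_gwa_op]

lemma gwa_op_gens: "mn [:0, 1:] 0 \<in> gwa_op a" "mn 1 1 \<in> gwa_op a" "mn a (-1) \<in> gwa_op a"
  using gen_in_range[of "gwa_gens 1 a" Gen_h] gen_in_range[of "gwa_gens 1 a" Gen_x]
    gen_in_range[of "gwa_gens 1 a" Gen_y] by (simp_all add: gwa_op_def)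

lemma wshift_0_closed: "mn p 0 \<in> gwa_op a"
proof (induction p)
  case (pCons c p)
  have "mn (pCons c p) 0 = scal c + mn [:0, 1:] 0 * mn p 0"
    by (simp add: scal_eq_wshift wshift_mult flip: wshift_add)
  then show ?case using pCons gwa_op_closed gwa_op_gens by metis
qed (simp add: gwa_op_closed)

lemma gwa_op_induct:
  assumes "subalgebra_op S" "mn [:0, 1:] 0 \<in> S" "mn 1 1 \<in> S" "mn a (-1) \<in> S"
  shows "gwa_op a \<subseteq> S"
  unfolding gwa_op_def
proof (rule range_free_eval_subset[OF assms(1)], rule image_subsetI)
  fix s
  show "gwa_gens 1 a s \<in> S" using assms by (cases s) simp_all
qed

text \<open>Every element has the same image as some normal form, and evaluating a normal form puts
  the factor \<open>xy_coeff a i\<close> into degree \<open>i\<close>. Through this divisibility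
  \<open>a\<close> remains visible among the skew Laurent polynomials.\<close>

lemma gwa_op_lin:
  assumes "a \<noteq> 0" "T \<in> gwa_op a"
  shows "\<exists>G. T = lin G \<and> (\<forall>i. xy_coeff a i dvd Poly_Mapping.lookup G i)"
proof -
  let ?F = "free_ring :: (gwa_gen, 'k) free_algebra ring"
  let ?ev = "free_eval (gwa_gens 1 a)"
  obtain p where p: "T = ?ev p" using assms(2) unfolding gwa_op_def by blast
  interpret F: ring ?F by (rule ring_ring_of_type_algebra)
  interpret gwa_ideal q a "Idl\<^bsub>?F\<^esub> (gwa_rels a)"
    by (intro gwa_ideal.intro gwa_ideal_axioms.intro skew_laurent_axioms F.genideal_ideal F.genideal_self) simp_all
  obtain F where "p - normal_form F \<in> Idl\<^bsub>?F\<^esub> (gwa_rels a)"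
    using normal_form_exists by blast
  then have "p - normal_form F \<in> a_kernel ?F ring_of_type_algebra ?ev"
    using gwa_kernel[OF assms(1), of 1] by simp
  then have "T = ?ev (normal_form F)"
    by (simp add: mem_kernel_free_eval free_eval_diff p)
  then show ?thesis
    unfolding eval_normal_form
    by (intro exI conjI) (auto simp: lookup_sum lookup_single when_def intro!: dvd_sum)
qed

lemma gwa_op_homogeneous_dvd:
  assumes "a \<noteq> 0" "mn f i \<in> gwa_op a"
  shows "xy_coeff a i dvd f"
  using gwa_op_lin[OF assms] by (metis lin_inject lin_single lookup_single_eq)

text \<open>The two generating sets differ only by nonzero scalar factors. This is the source of the
  isomorphism between algebras with related polynomials.\<close>

lemma range_gens_scaled:
  assumes "\<alpha> \<noteq> 0" "\<rho> \<noteq> 0" "b = Polynomial.smult \<rho> (pcompose a [:0, \<alpha>:])"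
  shows "range (free_eval (gwa_gens \<alpha> a)) = gwa_op b"
proof
  show "range (free_eval (gwa_gens \<alpha> a)) \<subseteq> gwa_op b"
  proof (rule range_free_eval_subset[OF subalgebra_gwa_op], rule image_subsetI)
    fix s
    have "mn [:0, \<alpha>:] 0 = scal \<alpha> * mn [:0, 1:] 0"
      "mn (pcompose a [:0, \<alpha>:]) (-1) = scal (inverse \<rho>) * mn b (-1)"
      using assms by (simp_all add: scal_mult_wshift)
    then show "gwa_gens \<alpha> a s \<in> gwa_op b"
      by (cases s) (auto intro: gwa_op_closed gwa_op_gens)
  qed
next
  let ?S = "range (free_eval (gwa_gens \<alpha> a))"
  note closed = subalgebra_opD[OF subalgebra_op_range[of "gwa_gens \<alpha> a"]]
  have "mn [:0, 1:] 0 = scal (inverse \<alpha>) * gwa_gens \<alpha> a Gen_h" "mn 1 1 = gwa_gens \<alpha> a Gen_x"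
    "mn b (-1) = scal \<rho> * gwa_gens \<alpha> a Gen_y"
    using assms by (simp_all add: scal_mult_wshift)
  then show "gwa_op b \<subseteq> ?S"
    by (intro gwa_op_induct subalgebra_op_range) (simp_all add: closed gen_in_range del: gwa_gens_simps)
qed

end

section \<open>Isomorphisms\<close>

lemma alg_iso_trans:
  assumes "\<Phi> \<in> alg_iso A B" "\<Psi> \<in> alg_iso B C"
  shows "\<Psi> \<circ> \<Phi> \<in> alg_iso A C"
  using assms ring_iso_set_trans[of \<Phi> A B \<Psi> C] ring_iso_memE(1)[of \<Phi> A B]
  unfolding alg_iso_def by auto

text \<open>The records come without ring axioms; closure of \<open>A\<close> guarantees that the
  results of operations on preimages are again the preimages chosen by
  \<open>inv_into\<close>.\<close>

lemma alg_iso_sym: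
  assumes \<Phi>: "\<Phi> \<in> alg_iso A B"
    and closed: "\<And>u v. u \<in> carrier A \<Longrightarrow> v \<in> carrier A \<Longrightarrow> u \<otimes>\<^bsub>A\<^esub> v \<in> carrier A"
      "\<And>u v. u \<in> carrier A \<Longrightarrow> v \<in> carrier A \<Longrightarrow> u \<oplus>\<^bsub>A\<^esub> v \<in> carrier A"
      "\<one>\<^bsub>A\<^esub> \<in> carrier A" "\<And>c u. u \<in> carrier A \<Longrightarrow> c \<odot>\<^bsub>A\<^esub> u \<in> carrier A"
  shows "inv_into (carrier A) \<Phi> \<in> alg_iso B A"
proof -
  let ?\<Psi> = "inv_into (carrier A) \<Phi>"
  have iso: "\<Phi> \<in> ring_iso A B"
    and smult: "\<And>c u. u \<in> carrier A \<Longrightarrow> \<Phi> (c \<odot>\<^bsub>A\<^esub> u) = c \<odot>\<^bsub>B\<^esub> \<Phi> u"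
    using \<Phi> unfolding alg_iso_def by auto
  have bij: "bij_betw \<Phi> (carrier A) (carrier B)" using ring_iso_memE(5)[OF iso] .
  have inv: "?\<Psi> v \<in> carrier A" "\<Phi> (?\<Psi> v) = v" if "v \<in> carrier B" for v
    using bij that by (auto simp: bij_betw_def inv_into_into f_inv_into_f)
  have eqI: "?\<Psi> v = u" if "u \<in> carrier A" "\<Phi> u = v" for u v
    using bij that by (auto simp: bij_betw_def)
  have "?\<Psi> \<in> ring_iso B A"
  proof (rule ring_iso_memI)
    show "bij_betw ?\<Psi> (carrier B) (carrier A)" using bij by (rule bij_betw_inv_into)
  qed (use ring_iso_memE[OF iso] inv closed in \<open>auto intro!: eqI\<close>)
  then show ?thesis
    unfolding alg_iso_def using inv closed smult by (auto intro!: eqI)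
qed

section \<open>Normal elements\<close>

text \<open>The one-sided form \<open>u S \<subseteq> S u\<close> of normality, which is preserved
  by isomorphisms and can be tested on generators.\<close>

definition normal_in :: "'k::field linop set \<Rightarrow> 'k linop \<Rightarrow> bool"
  where "normal_in S u \<longleftrightarrow> u \<in> S \<and> (\<forall>v\<in>S. \<exists>w\<in>S. u * v = w * u)"

context skew_laurent
begin

definition is_monomial :: "'k linop \<Rightarrow> nat \<Rightarrow> int \<Rightarrow> bool"
  where "is_monomial T j i \<longleftrightarrow> (\<exists>c. c \<noteq> 0 \<and> T = mn (monom c j) i)"

lemma is_monomial_unique: "is_monomial T j i \<Longrightarrow> is_monomial T j' i' \<Longrightarrow> j = j' \<and> i = i'"
  unfolding is_monomial_def by (auto simp: wshift_inject monom_eq_iff')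

lemma is_monomial_mult:
  assumes "is_monomial T j i" "is_monomial U j' i'"
  shows "is_monomial (T * U) (j + j') (i + i')"
proof -
  obtain c d where "c \<noteq> 0" "T = mn (monom c j) i" "d \<noteq> 0" "U = mn (monom d j') i'"
    using assms unfolding is_monomial_def by blast
  then show ?thesis
    unfolding is_monomial_def
    by (intro exI[of _ "c * (d * (q powi i) ^ j')"])
      (simp add: wshift_mult tw_monom mult_monom q_nonzero)
qed

lemma is_monomial_scal: "c \<noteq> 0 \<Longrightarrow> is_monomial T j i \<Longrightarrow> is_monomial (scal c * T) j i"
  unfolding is_monomial_def by (metis mult_eq_0_iff scal_mult_wshift smult_monom)

lemma is_monomial_power: "is_monomial T j i \<Longrightarrow> is_monomial (T ^ e) (e * j) (int e * i)"
proof (induction e)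
  case 0
  then show ?case by (auto simp: is_monomial_def monom_0 simp flip: one_pCons intro!: exI[of _ 1])
next
  case (Suc e)
  then show ?case using is_monomial_mult[of T j i "T ^ e"] by (simp add: distrib_right)
qed

text \<open>A nonzero coefficient at \<open>k\<close> forces q^(i k) = e, and distinct powers of
  \<open>q\<close> leave room for only one such \<open>k\<close>.\<close>

lemma monom_if_tw_eigen:
  assumes "tw i p = Polynomial.smult e p" "i \<noteq> 0"
  shows "p = monom (lead_coeff p) (degree p)"
proof (rule poly_eqI)
  fix k
  have e: "q powi (i * int k) = e" if "coeff p k \<noteq> 0" for k
    using arg_cong[OF assms(1), of "\<lambda>r. coeff r k"] that
    by (simp add: coeff_tw power_int_mult)
  have "k = degree p" if "coeff p k \<noteq> 0"
  proof -
    have "coeff p (degree p) \<noteq> 0" using that by fastforce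
    then have "i * int k = i * int (degree p)"
      using e[OF that] e[of "degree p"] q_powi_eq_iff by metis
    then show ?thesis using assms(2) by simp
  qed
  then show "coeff p k = coeff (monom (lead_coeff p) (degree p)) k"
    by auto
qed

text \<open>The twist preserves the degree, so the cofactor is constant.\<close>

lemma tw_eigen_if_dvd:
  assumes "tw i p = g * p" "p \<noteq> 0"
  shows "\<exists>e. g = [:e:]"
proof -
  have "g \<noteq> 0" using assms tw_eq_0_iff[of i p] by auto
  then have "degree g = 0"
    using arg_cong[OF assms(1), of degree] assms(2) by (simp add: degree_mult_eq)
  then show ?thesis by (rule degree_eq_zeroE) blast
qed

text \<open>For negative \<open>i\<close> the coefficient is divisible by
  \<open>y_coeff a (nat (- i))\<close>, whose degree is \<open>nat (- i) * degree a\<close>.\<close>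

lemma gwa_op_degree_bound:
  assumes "a \<noteq> 0" "f \<noteq> 0" "mn f i \<in> gwa_op a"
  shows "0 \<le> int (degree f) + int (degree a) * i"
proof (cases "i \<ge> 0")
  case False
  then have "y_coeff a (nat (- i)) dvd f"
    using gwa_op_homogeneous_dvd[OF assms(1,3)] by (simp add: xy_coeff_def)
  then have "nat (- i) * degree a \<le> degree f"
    using dvd_imp_degree_le[OF _ assms(2)] degree_y_coeff[OF assms(1)] by metis
  then have "int (nat (- i)) * int (degree a) \<le> int (degree f)"
    by (metis of_nat_le_iff of_nat_mult)
  then show ?thesis using False by (simp add: algebra_simps)
qed simp

lemma xy_coeff_minus_1 [simp]: "xy_coeff a (-1) = a"
  using y_coeff.simps(2)[of a 0] by (simp add: xy_coeff_def)

text \<open>Moving \<open>u\<close> past h makes it homogeneous, moving it past x makes its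
  coefficient a monomial, and moving it past y makes \<open>a\<close> an eigenvector of
  \<open>tw i\<close>.\<close>

lemma normal_elements:
  assumes "degree a > 0" and normal: "normal_in (gwa_op a) u" and "u \<noteq> 0"
  obtains j i where "is_monomial u j i" "0 \<le> int j + int (degree a) * i"
    "i \<noteq> 0 \<Longrightarrow> a = monom (lead_coeff a) (degree a)"
proof -
  have a: "a \<noteq> 0" using assms(1) by auto
  have lin: "\<exists>G. v = lin G" if "v \<in> gwa_op a" for v
    using gwa_op_lin[OF a that] by blast
  have u: "u \<in> gwa_op a" using normal by (simp add: normal_in_def)
  obtain F where F: "u = lin F" using lin[OF u] by blast
  \<comment> \<open>The factor that appears on the left is homogeneous of the same degree as the one
    on the right.\<close>
  have skew: "\<exists>g. mn g d \<in> gwa_op a \<and> u * mn r d = mn g d * u" if "mn r d \<in> gwa_op a" for r d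
  proof -
    have "\<forall>v\<in>gwa_op a. \<exists>w\<in>gwa_op a. u * v = w * u"
      using normal unfolding normal_in_def by (rule conjunct2)
    from bspec[OF this that] obtain w where w: "w \<in> gwa_op a" "u * mn r d = w * u" ..
    obtain G where G: "w = lin G" using lin[OF w(1)] by blast
    have "\<exists>g. lin G = mn g d"
      by (rule homogeneous_if_skew_commute) (use w(2) F G \<open>u \<noteq> 0\<close> in simp_all)
    then show ?thesis using w unfolding G by metis
  qed
  obtain p where "u * mn [:0, 1:] 0 = mn p 0 * u"
    using skew[OF gwa_op_gens(1)] by blast
  then obtain f i where f: "u = mn f i"
    using homogeneous_if_commute_h[of F p] F \<open>u \<noteq> 0\<close> by blast
  have "f \<noteq> 0" using f \<open>u \<noteq> 0\<close> by auto
  obtain g where "u * mn 1 1 = mn g 1 * u"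
    using skew[OF gwa_op_gens(2)] by blast
  then have g: "f = g * tw 1 f"
    using \<open>f \<noteq> 0\<close> by (auto simp: f wshift_mult wshift_inject)
  \<comment> \<open>Applying \<open>tw (-1)\<close> to \<open>f = g * tw 1 f\<close> gives an
    eigenvector equation, so far with a polynomial factor.\<close>
  then have "tw (-1) f = tw (-1) g * f"
    using tw_mult[of "-1" g "tw 1 f"] q_nonzero
    by (simp add: tw_def power_int_minus flip: pcompose_assoc) (simp add: pcompose_pCons)
  then obtain e where e: "tw (-1) f = Polynomial.smult e f"
    using tw_eigen_if_dvd[OF _ \<open>f \<noteq> 0\<close>] by fastforce
  then have f_monom: "f = monom (lead_coeff f) (degree f)"
    by (rule monom_if_tw_eigen) simp
  obtain g where g: "mn g (-1) \<in> gwa_op a" "u * mn a (-1) = mn g (-1) * u"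
    using skew[OF gwa_op_gens(3)] by blast
  \<comment> \<open>Membership in degree -1 supplies a factor \<open>a\<close>; once
    \<open>f\<close> is cancelled it exhibits \<open>tw i a\<close> as a multiple of
    \<open>a\<close>.\<close>
  have "xy_coeff a (-1) dvd g" by (rule gwa_op_homogeneous_dvd[OF a g(1)])
  then obtain g' where g': "g = a * g'" by auto
  have "f * tw i a \<noteq> 0" using \<open>f \<noteq> 0\<close> a by simp
  then have "f * tw i a = g * tw (-1) f"
    using g(2) by (simp add: f wshift_mult wshift_inject add.commute)
  then have "f * tw i a = f * (Polynomial.smult e g' * a)"
    by (simp add: g' e mult.commute mult.left_commute)
  then have "tw i a = Polynomial.smult e g' * a"
    using \<open>f \<noteq> 0\<close> by (simp only: mult_cancel_left) simp
  then obtain e' where "tw i a = Polynomial.smult e' a"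
    using tw_eigen_if_dvd[OF _ a, of i "Polynomial.smult e g'"] by fastforce
  then have "i \<noteq> 0 \<Longrightarrow> a = monom (lead_coeff a) (degree a)"
    by (rule monom_if_tw_eigen)
  moreover have "is_monomial u (degree f) i"
    unfolding is_monomial_def using f f_monom \<open>f \<noteq> 0\<close> by (metis leading_coeff_0_iff)
  moreover have "0 \<le> int (degree f) + int (degree a) * i"
    using gwa_op_degree_bound[OF a \<open>f \<noteq> 0\<close>] u f by simp
  ultimately show ?thesis using that by blast
qed

text \<open>The operators \<open>v\<close> for which \<open>u * v\<close> is a left multiple of
  \<open>u\<close> form a subalgebra, so the three generators suffice.\<close>

lemma normal_inI:
  assumes u: "u \<in> gwa_op a"
    and "\<exists>w\<in>gwa_op a. u * mn [:0, 1:] 0 = w * u"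
    and "\<exists>w\<in>gwa_op a. u * mn 1 1 = w * u"
    and "\<exists>w\<in>gwa_op a. u * mn a (-1) = w * u"
  shows "normal_in (gwa_op a) u"
proof -
  let ?T = "{v. \<exists>w\<in>gwa_op a. u * v = w * u}"
  have "subalgebra_op ?T"
    unfolding subalgebra_op_def
  proof (intro conjI ballI)
    show "range scal \<subseteq> ?T"
      using gwa_op_closed(1) by (auto simp: scal_comm)
  next
    fix v v' assume "v \<in> ?T" "v' \<in> ?T"
    then obtain w w' where w: "w \<in> gwa_op a" "u * v = w * u" "w' \<in> gwa_op a" "u * v' = w' * u"
      by blast
    have "u * (v + v') = (w + w') * u" using w by (simp add: algebra_simps)
    then show "v + v' \<in> ?T" using w gwa_op_closed(2) by blast
    have "u * (v * v') = (w * w') * u" using w by (metis mult.assoc)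
    then show "v * v' \<in> ?T" using w gwa_op_closed(3) by blast
  qed
  then have "gwa_op a \<subseteq> ?T"
    using assms by (intro gwa_op_induct) auto
  then show ?thesis using u by (auto simp: normal_in_def)
qed

lemma normal_inI_scal:
  assumes "u \<in> gwa_op a" "u * mn [:0, 1:] 0 = scal c * mn [:0, 1:] 0 * u"
    "u * mn 1 1 = scal d * mn 1 1 * u" "u * mn a (-1) = scal e * mn a (-1) * u"
  shows "normal_in (gwa_op a) u"
  using assms by (intro normal_inI) (metis gwa_op_closed(1,3) gwa_op_gens)+

lemma normal_h: "normal_in (gwa_op a) (mn [:0, 1:] 0)"
  by (rule normal_inI_scal[where c = 1 and d = "inverse q" and e = q])
    (simp_all add: gwa_op_gens wshift_mult scal_mult_wshift tw_pCons q_nonzero)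

text \<open>For a = \<rho> h^n the relations give x y = q^n y x, so x commutes with every generator
  up to a scalar; likewise for y below.\<close>

lemma normal_x:
  assumes "a = monom \<rho> n" shows "normal_in (gwa_op a) (mn 1 1)"
  by (rule normal_inI_scal[where c = q and d = 1 and e = "q ^ n"])
    (simp_all add: gwa_op_gens wshift_mult scal_mult_wshift tw_pCons tw_monom assms smult_monom mult.commute)

lemma normal_y:
  assumes "a = monom \<rho> n" shows "normal_in (gwa_op a) (mn a (-1))"
  by (rule normal_inI_scal[where c = "inverse q" and d = "inverse q ^ n" and e = 1])
    (simp_all add: gwa_op_gens wshift_mult scal_mult_wshift tw_pCons tw_monom assms smult_monom q_nonzero
      mult.commute field_simps)

end

section \<open>The image of the generators under an isomorphism\<close>

locale gwa_op_iso = skew_laurent q for q :: "'k::field" +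
  fixes a1 a2 :: "'k poly" and \<psi> :: "'k linop \<Rightarrow> 'k linop"
  assumes degree_a1: "degree a1 > 0" and degree_a2: "degree a2 > 0"
    and iso: "\<psi> \<in> alg_iso (op_algebra (gwa_op a1)) (op_algebra (gwa_op a2))"
begin

lemma a1_nonzero: "a1 \<noteq> 0" and a2_nonzero: "a2 \<noteq> 0"
  using degree_a1 degree_a2 by auto

lemma ring_iso: "\<psi> \<in> ring_iso (op_algebra (gwa_op a1)) (op_algebra (gwa_op a2))"
  using iso by (simp add: alg_iso_def)

lemma psi_closed: "u \<in> gwa_op a1 \<Longrightarrow> \<psi> u \<in> gwa_op a2"
  using ring_iso_memE(1)[OF ring_iso] by simp

lemma psi_mult: "u \<in> gwa_op a1 \<Longrightarrow> v \<in> gwa_op a1 \<Longrightarrow> \<psi> (u * v) = \<psi> u * \<psi> v"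
  using ring_iso_memE(2)[OF ring_iso] by simp

lemma psi_add: "u \<in> gwa_op a1 \<Longrightarrow> v \<in> gwa_op a1 \<Longrightarrow> \<psi> (u + v) = \<psi> u + \<psi> v"
  using ring_iso_memE(3)[OF ring_iso] by simp

lemma psi_1: "\<psi> 1 = 1"
  using ring_iso_memE(4)[OF ring_iso] by simp

lemma psi_bij: "bij_betw \<psi> (gwa_op a1) (gwa_op a2)"
  using ring_iso_memE(5)[OF ring_iso] by simp

lemma psi_scal_mult: "u \<in> gwa_op a1 \<Longrightarrow> \<psi> (scal c * u) = scal c * \<psi> u"
  using iso by (simp add: alg_iso_def)

lemma psi_scal: "\<psi> (scal c) = scal c"
  using psi_scal_mult[of 1 c] by (simp add: psi_1 gwa_op_closed)

lemma psi_power: "u \<in> gwa_op a1 \<Longrightarrow> u ^ n \<in> gwa_op a1 \<and> \<psi> (u ^ n) = \<psi> u ^ n"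
  by (induction n) (simp_all add: psi_1 psi_mult gwa_op_closed)

lemma psi_0: "\<psi> 0 = 0"
  using psi_scal[of 0] by simp

lemma psi_nonzero: "u \<in> gwa_op a1 \<Longrightarrow> u \<noteq> 0 \<Longrightarrow> \<psi> u \<noteq> 0"
  using psi_bij psi_0 gwa_op_closed(4) by (metis bij_betw_inv_into_left)

definition \<psi>' :: "'k linop \<Rightarrow> 'k linop" where "\<psi>' = inv_into (gwa_op a1) \<psi>"

lemma psi_inverse: "v \<in> gwa_op a2 \<Longrightarrow> \<psi> (\<psi>' v) = v"
  unfolding \<psi>'_def using psi_bij by (rule bij_betw_inv_into_right)

text \<open>Makes every result of the locale available with \<open>a1\<close> and \<open>a2\<close>
  exchanged.\<close>

lemma inverse_iso: "gwa_op_iso q a2 a1 \<psi>'"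
proof
  show "\<psi>' \<in> alg_iso (op_algebra (gwa_op a2)) (op_algebra (gwa_op a1))"
    using alg_iso_sym[OF iso] gwa_op_closed by (simp add: \<psi>'_def)
qed (fact degree_a1 degree_a2)+

lemma psi_normal:
  assumes "normal_in (gwa_op a1) u" shows "normal_in (gwa_op a2) (\<psi> u)"
  unfolding normal_in_def
proof (intro conjI ballI)
  have u: "u \<in> gwa_op a1" using assms by (simp add: normal_in_def)
  then show "\<psi> u \<in> gwa_op a2" by (rule psi_closed)
  fix v assume "v \<in> gwa_op a2"
  then obtain v' where v': "v' \<in> gwa_op a1" "v = \<psi> v'"
    using psi_bij by (auto simp: bij_betw_def)
  then obtain w where "w \<in> gwa_op a1" "u * v' = w * u"
    using assms unfolding normal_in_def by blast
  then show "\<exists>w\<in>gwa_op a2. \<psi> u * v = w * \<psi> u"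
    using u v' psi_closed psi_mult by metis
qed

lemma psi_poly:
  assumes "\<psi> (mn [:0, 1:] 0) = mn f 0"
  shows "\<psi> (mn p 0) = mn (pcompose p f) 0"
proof (induction p)
  case (pCons c p)
  have "mn (pCons c p) 0 = scal c + mn [:0, 1:] 0 * mn p 0"
    by (simp add: scal_eq_wshift wshift_mult flip: wshift_add)
  then have "\<psi> (mn (pCons c p) 0) = scal c + mn f 0 * mn (pcompose p f) 0"
    using pCons assms
    by (simp add: psi_add psi_mult psi_scal gwa_op_closed gwa_op_gens wshift_0_closed)
  then show ?case
    by (simp add: scal_eq_wshift wshift_mult pcompose_pCons flip: wshift_add)
qed (simp add: psi_0)

lemma psi_gen_relations:
  "\<psi> (mn 1 1) * \<psi> (mn [:0, 1:] 0) = scal q * \<psi> (mn [:0, 1:] 0) * \<psi> (mn 1 1)"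
  "\<psi> (mn a1 (-1)) * \<psi> (mn [:0, 1:] 0) = scal (inverse q) * \<psi> (mn [:0, 1:] 0) * \<psi> (mn a1 (-1))"
  "\<psi> (mn a1 (-1)) * \<psi> (mn 1 1) = \<psi> (mn a1 0)"
proof -
  have "mn 1 1 * mn [:0, 1:] 0 = scal q * mn [:0, 1:] 0 * mn 1 1"
    "mn a1 (-1) * mn [:0, 1:] 0 = scal (inverse q) * mn [:0, 1:] 0 * mn a1 (-1)"
    "mn a1 (-1) * mn 1 1 = mn a1 0"
    by (simp_all add: wshift_mult scal_mult_wshift tw_pCons)
  from this[THEN arg_cong[of _ _ \<psi>]] show
    "\<psi> (mn 1 1) * \<psi> (mn [:0, 1:] 0) = scal q * \<psi> (mn [:0, 1:] 0) * \<psi> (mn 1 1)"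
    "\<psi> (mn a1 (-1)) * \<psi> (mn [:0, 1:] 0) = scal (inverse q) * \<psi> (mn [:0, 1:] 0) * \<psi> (mn a1 (-1))"
    "\<psi> (mn a1 (-1)) * \<psi> (mn 1 1) = \<psi> (mn a1 0)"
    by (simp_all add: psi_mult psi_scal gwa_op_gens gwa_op_closed)
qed

text \<open>Dividing by \<alpha> reduces the hypothesis to commutation with h itself, where the
  eigenvalue q^d determines the degree.\<close>

lemma eigen_homogeneous:
  assumes "v \<in> gwa_op a2" "v \<noteq> 0" "\<alpha> \<noteq> 0"
    and "v * mn [:0, \<alpha>:] 0 = scal (q powi d) * mn [:0, \<alpha>:] 0 * v"
  shows "\<exists>f. v = mn f d"
proof -
  obtain F where F: "v = lin F" using gwa_op_lin[OF a2_nonzero assms(1)] by blast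
  have \<alpha>: "mn [:0, 1:] 0 = scal (inverse \<alpha>) * mn [:0, \<alpha>:] 0"
    using assms(3) by (simp add: scal_mult_wshift)
  have "v * mn [:0, 1:] 0 = scal (inverse \<alpha>) * (v * mn [:0, \<alpha>:] 0)"
    unfolding \<alpha> by (metis mult.assoc scal_comm)
  also have "\<dots> = scal (inverse \<alpha>) * (scal (q powi d) * mn [:0, \<alpha>:] 0) * v"
    unfolding assms(4) by (simp add: mult.assoc)
  also have "scal (inverse \<alpha>) * (scal (q powi d) * mn [:0, \<alpha>:] 0) = mn [:0, q powi d:] 0"
    using assms(3) by (simp add: scal_mult_wshift field_simps)
  finally obtain f i where "v = mn f i" "[:0, q powi d:] = [:0, q powi i:]"
    using homogeneous_if_commute_h assms(2) unfolding F by blast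
  then show ?thesis using q_powi_eq_iff by auto
qed

lemma dvd_if_degree_0:
  assumes "is_monomial (\<psi> (mn [:0, 1:] 0)) j 0" "is_monomial (\<psi>' (mn [:0, 1:] 0)) k 0"
  shows "\<exists>\<alpha>. \<alpha> \<noteq> 0 \<and> a2 dvd pcompose a1 [:0, \<alpha>:]"
proof -
  obtain \<alpha> \<beta> where \<alpha>: "\<alpha> \<noteq> 0" "\<psi> (mn [:0, 1:] 0) = mn (monom \<alpha> j) 0"
    and \<beta>: "\<beta> \<noteq> 0" "\<psi>' (mn [:0, 1:] 0) = mn (monom \<beta> k) 0"
    using assms unfolding is_monomial_def by blast
  \<comment> \<open>Composing the two images recovers h, so k j = 1 and h is only rescaled.\<close>
  have "mn [:0, 1:] 0 = mn (pcompose (monom \<beta> k) (monom \<alpha> j)) 0"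
    using psi_inverse[OF gwa_op_gens(1)] psi_poly[OF \<alpha>(2)] \<beta>(2) by simp
  then have "[:0, 1:] = pcompose (monom \<beta> k) (monom \<alpha> j)"
    by (simp add: wshift_inject)
  then have "degree (pcompose (monom \<beta> k) (monom \<alpha> j)) = 1"
    by (metis degree_pCons_eq_if degree_1 one_neq_zero one_pCons pCons_eq_0_iff One_nat_def)
  then have "k * j = 1"
    using \<alpha>(1) \<beta>(1) by (simp add: degree_pcompose degree_monom_eq)
  then have h: "\<psi> (mn [:0, 1:] 0) = mn [:0, \<alpha>:] 0"
    using \<alpha>(2) by (simp add: monom_altdef)
  have "mn 1 1 \<noteq> 0" "mn a1 (-1) \<noteq> 0"
    using a1_nonzero by simp_all
  then obtain f g where f: "\<psi> (mn 1 1) = mn f 1" and g: "\<psi> (mn a1 (-1)) = mn g (-1)"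
    using eigen_homogeneous[OF psi_closed[OF gwa_op_gens(2)] psi_nonzero[OF gwa_op_gens(2)] \<alpha>(1), of 1]
      eigen_homogeneous[OF psi_closed[OF gwa_op_gens(3)] psi_nonzero[OF gwa_op_gens(3)] \<alpha>(1), of "-1"]
      psi_gen_relations(1,2) unfolding h by (auto simp: power_int_minus)
  \<comment> \<open>The image of y x = a1(h); the image of y has degree -1, so its coefficient
    \<open>g\<close> carries the factor \<open>a2\<close>.\<close>
  have "mn (g * tw (-1) f) 0 = mn (pcompose a1 [:0, \<alpha>:]) 0"
    using psi_gen_relations(3) unfolding f g psi_poly[OF h] by (simp add: wshift_mult)
  then have "g * tw (-1) f = pcompose a1 [:0, \<alpha>:]"
    by (simp add: wshift_inject)
  moreover have "a2 dvd g"
    using gwa_op_homogeneous_dvd[OF a2_nonzero, of g "-1"] psi_closed[OF gwa_op_gens(3)] g by simp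
  ultimately show ?thesis
    using \<alpha>(1) by (metis dvd_mult2)
qed

text \<open>For \<open>a2\<close> this is part of \<open>normal_elements\<close>. If
  \<open>a1\<close> were no monomial, the inverse would send h and x, both normal since
  \<open>a2\<close> is a monomial, to elements of degree 0. Those commute, whereas h and x do
  not.\<close>

lemma monomial_if_nonzero_degree:
  assumes "is_monomial (\<psi> (mn [:0, 1:] 0)) j i" "i \<noteq> 0"
  shows "a2 = monom (lead_coeff a2) (degree a2)" "a1 = monom (lead_coeff a1) (degree a1)"
proof -
  interpret inv: gwa_op_iso q a2 a1 \<psi>' by (rule inverse_iso)
  have "\<psi> (mn [:0, 1:] 0) \<noteq> 0"
    by (simp add: psi_nonzero gwa_op_gens)
  then obtain j' i' where "is_monomial (\<psi> (mn [:0, 1:] 0)) j' i'"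
    "i' \<noteq> 0 \<Longrightarrow> a2 = monom (lead_coeff a2) (degree a2)"
    using normal_elements[OF degree_a2 psi_normal[OF normal_h]] by metis
  then show a2: "a2 = monom (lead_coeff a2) (degree a2)"
    using is_monomial_unique assms by metis
  show "a1 = monom (lead_coeff a1) (degree a1)"
  proof (rule ccontr)
    assume neq: "a1 \<noteq> monom (lead_coeff a1) (degree a1)"
    have deg0: "\<exists>f. \<psi>' v = mn f 0" if "normal_in (gwa_op a2) v" "v \<noteq> 0" for v
    proof -
      have "v \<in> gwa_op a2" using that by (simp add: normal_in_def)
      then show ?thesis
        using normal_elements[OF degree_a1 inv.psi_normal[OF that(1)] inv.psi_nonzero] that neq
        unfolding is_monomial_def by metis
    qed
    obtain f g where "\<psi>' (mn [:0, 1:] 0) = mn f 0" "\<psi>' (mn 1 1) = mn g 0"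
      using deg0[OF normal_h] deg0[OF normal_x[OF a2]] by auto
    then have "\<psi>' (mn [:0, 1:] 0) * \<psi>' (mn 1 1) = \<psi>' (mn 1 1) * \<psi>' (mn [:0, 1:] 0)"
      by (simp add: wshift_mult mult.commute)
    then have "\<psi>' (mn [:0, 1:] 0 * mn 1 1) = \<psi>' (mn 1 1 * mn [:0, 1:] 0)"
      by (simp only: inv.psi_mult gwa_op_gens)
    then have "mn [:0, 1:] 0 * mn 1 1 = mn 1 1 * mn [:0, 1:] 0"
      by (metis psi_inverse gwa_op_closed(3) gwa_op_gens(1,2))
    then show False
      using q_not_root_of_unity[of 1] by (simp add: wshift_mult wshift_inject tw_pCons)
  qed
qed

text \<open>In the coordinates \<open>(s, t) = (j, j + n i)\<close> of a monomial \<open>h\<^sup>j x\<^sup>i\<close> the generators \<open>x\<close> and \<open>y\<close> lie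
  on the two boundary rays of the quadrant \<open>s, t \<ge> 0\<close>, which are therefore spanned by images of
  generators.\<close>

lemma degree_le_if_monomials:
  assumes a1: "a1 = monom (lead_coeff a1) (degree a1)" and a2: "a2 = monom (lead_coeff a2) (degree a2)"
  shows "degree a1 \<le> degree a2"
proof -
  let ?m = "degree a1" and ?n = "degree a2" and ?h = "mn [:0, 1:] 0" and ?x = "mn 1 1" and ?y = "mn a1 (-1)"
  interpret inv: gwa_op_iso q a2 a1 \<psi>' by (rule inverse_iso)
  have image: "\<exists>j i. is_monomial (\<psi> v) j i \<and> 0 \<le> int j + int ?n * i"
    if "normal_in (gwa_op a1) v" "v \<noteq> 0" for v
  proof -
    have "v \<in> gwa_op a1" using that by (simp add: normal_in_def)
    then show ?thesis
      using normal_elements[OF degree_a2 psi_normal[OF that(1)] psi_nonzero] that by metis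
  qed
  obtain jh ih where h: "is_monomial (\<psi> ?h) jh ih" "0 \<le> int jh + int ?n * ih"
    using image[OF normal_h] by auto
  obtain jx ix where x: "is_monomial (\<psi> ?x) jx ix" "0 \<le> int jx + int ?n * ix"
    using image[OF normal_x[OF a1]] by auto
  obtain jy iy where y: "is_monomial (\<psi> ?y) jy iy" "0 \<le> int jy + int ?n * iy"
    using image[OF normal_y[OF a1]] a1_nonzero by auto
  have h_gen: "is_monomial ?h 1 0" and x_gen: "is_monomial ?x 0 1"
    by (auto simp: is_monomial_def monom_altdef one_pCons intro!: exI[of _ 1])
  have y_gen: "is_monomial ?y ?m (-1)"
    unfolding is_monomial_def using a1 a1_nonzero by (metis leading_coeff_0_iff)

  \<comment> \<open>As y x is a scalar multiple of h^m, the exponents of the images of x and y add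
    up to m times those of the image of h.\<close>
  have "mn (monom c n) 0 = scal c * ?h ^ n" for c n
    by (simp add: wshift_power_0 scal_mult_wshift monom_altdef)
  then have "mn a1 0 = scal (lead_coeff a1) * ?h ^ ?m"
    using a1 by metis
  then have "\<psi> ?y * \<psi> ?x = scal (lead_coeff a1) * \<psi> ?h ^ ?m"
    using psi_gen_relations(3) psi_power[OF gwa_op_gens(1)] by (simp add: psi_scal_mult)
  then have "is_monomial (\<psi> ?y * \<psi> ?x) (?m * jh) (int ?m * ih)"
    using is_monomial_scal[OF _ is_monomial_power[OF h(1)]] a1_nonzero by simp
  then have sum: "jy + jx = ?m * jh" "iy + ix = int ?m * ih"
    using is_monomial_mult[OF y(1) x(1)] is_monomial_unique by blast+

  obtain c d where c: "c \<noteq> 0" "\<psi> ?x = mn (monom c jx) ix" and d: "d \<noteq> 0" "\<psi> ?h = mn (monom d jh) ih"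
    using x(1) h(1) unfolding is_monomial_def by blast
  \<comment> \<open>Comparing scalars in x h = q h x shows that the exponent vectors of the images
    of h and x have determinant 1.\<close>
  have "q powi (ix * int jh) = q * q powi (ih * int jx)"
    using psi_gen_relations(1) c(1) d(1) unfolding c(2) d(2)
    by (simp add: wshift_mult scal_mult_wshift tw_monom mult_monom smult_monom wshift_inject
        monom_eq_iff' add.commute power_int_mult)
  also have "\<dots> = q powi (1 + ih * int jx)"
    by (simp add: power_int_add q_nonzero)
  finally have det: "ix * int jh = 1 + ih * int jx"
    by (simp add: q_powi_eq_iff)

  \<comment> \<open>The preimage of a normal element is a monomial, hence up to a scalar h^e times a
    power of x or of y. Applying \<psi> turns this into a nonnegative combination of
    exponents.\<close>
  have generated: "\<exists>e f jz iz. (jz = jx \<and> iz = ix \<or> jz = jy \<and> iz = iy) \<and>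
      j = e * jh + f * jz \<and> i = int e * ih + int f * iz"
    if v: "normal_in (gwa_op a2) v" and j: "is_monomial v j i" for v j i
  proof -
    have v_in: "v \<in> gwa_op a2" using v by (simp add: normal_in_def)
    have "v \<noteq> 0" using j by (auto simp: is_monomial_def)
    then obtain k l where kl: "is_monomial (\<psi>' v) k l" "0 \<le> int k + int ?m * l"
      using normal_elements[OF degree_a1 inv.psi_normal[OF v] inv.psi_nonzero[OF v_in]] by metis
    have step: ?thesis
      if z: "z \<in> gwa_op a1" "is_monomial (\<psi> z) jz iz" "jz = jx \<and> iz = ix \<or> jz = jy \<and> iz = iy"
        and zf: "is_monomial (?h ^ e * z ^ f) k l" for z jz iz e f
    proof -
      obtain b b' where b: "b \<noteq> 0" "\<psi>' v = mn (monom b k) l" "b' \<noteq> 0" "?h ^ e * z ^ f = mn (monom b' k) l"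
        using kl(1) zf unfolding is_monomial_def by blast
      then have "\<psi>' v = scal (b / b') * (?h ^ e * z ^ f)"
        by (simp add: scal_mult_wshift smult_monom)
      then have "v = scal (b / b') * (\<psi> ?h ^ e * \<psi> z ^ f)"
        using psi_inverse[OF v_in] psi_power[OF z(1)] psi_power[OF gwa_op_gens(1)]
        by (simp add: psi_scal psi_mult gwa_op_closed)
      moreover have "is_monomial (scal (b / b') * (\<psi> ?h ^ e * \<psi> z ^ f))
          (e * jh + f * jz) (int e * ih + int f * iz)"
        using b by (intro is_monomial_scal is_monomial_mult is_monomial_power h z) simp
      ultimately have "j = e * jh + f * jz \<and> i = int e * ih + int f * iz"
        using is_monomial_unique[OF j] by simp
      then show ?thesis using z(3) by blast
    qed
    show ?thesis
    proof (cases "l \<ge> 0")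
      case True
      then have "is_monomial (?h ^ k * ?x ^ nat l) k l"
        using is_monomial_mult[OF is_monomial_power[OF h_gen, of k] is_monomial_power[OF x_gen, of "nat l"]]
        by simp
      then show ?thesis using step[OF gwa_op_gens(2) x(1)] by blast
    next
      case False
      \<comment> \<open>The bound k + m l \<ge> 0 allows h^k x^l to be written as h^(k + m l) y^(-l)
        up to a scalar.\<close>
      then have "int (nat (- l) * ?m) \<le> int k" using kl(2) by (simp add: algebra_simps)
      then have le: "nat (- l) * ?m \<le> k" by (simp only: of_nat_le_iff)
      let ?e = "k - nat (- l) * ?m"
      have "is_monomial (?h ^ ?e * ?y ^ nat (- l)) (?e * 1 + nat (- l) * ?m) (int ?e * 0 + int (nat (- l)) * (-1))"
        by (intro is_monomial_mult is_monomial_power h_gen y_gen)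
      moreover have "?e * 1 + nat (- l) * ?m = k" "int ?e * 0 + int (nat (- l)) * (-1) = l"
        using False le by simp_all
      ultimately have "is_monomial (?h ^ ?e * ?y ^ nat (- l)) k l" by (simp only:)
      then show ?thesis using step[OF gwa_op_gens(3) y(1)] by blast
    qed
  qed

  define th tx ty where t: "th = int jh + int ?n * ih" "tx = int jx + int ?n * ix" "ty = int jy + int ?n * iy"
  have t_nonneg: "0 \<le> th" "0 \<le> tx" "0 \<le> ty" using h(2) x(2) y(2) by (simp_all add: t)
  have n: "0 < ?n" using degree_a2 .
  have t_sum: "ty + tx = int ?m * th"
  proof -
    have "ty + tx = int (jy + jx) + int ?n * (iy + ix)" by (simp add: t algebra_simps)
    then show ?thesis unfolding sum by (simp add: t algebra_simps)
  qed
  have t_det: "tx * int jh - th * int jx = int ?n"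
  proof -
    have "tx * int jh - th * int jx = int ?n * (ix * int jh - ih * int jx)"
      by (simp add: t algebra_simps)
    then show ?thesis by (simp add: det)
  qed
  have s_ray: "jx = 0 \<or> jy = 0"
  proof -
    \<comment> \<open>The element x of the second algebra has s = 0, so every image occurring in its
      combination has s = 0. If that of h occurs, \<open>sum\<close> puts those of x and y there
      too.\<close>
    have "is_monomial (mn 1 1) 0 1" by (auto simp: is_monomial_def monom_altdef one_pCons intro!: exI[of _ 1])
    from generated[OF normal_x[OF a2] this] obtain e f jz iz where
      z: "jz = jx \<and> iz = ix \<or> jz = jy \<and> iz = iy" "0 = e * jh + f * jz" "1 = int e * ih + int f * iz"
      by blast
    then have "e = 0 \<and> f > 0 \<and> jz = 0 \<or> jh = 0" by (cases "e = 0"; cases "f = 0") auto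
    then show ?thesis using z(1) sum(1) by auto
  qed
  have t_ray: "tx = 0 \<or> ty = 0"
  proof -
    \<comment> \<open>Dually, y of the second algebra has exponents (n, -1) and hence t = 0.\<close>
    have "is_monomial (mn a2 (-1)) ?n (-1)"
      unfolding is_monomial_def using a2 a2_nonzero by (metis leading_coeff_0_iff)
    from generated[OF normal_y[OF a2] this] obtain e f jz iz where
      z: "jz = jx \<and> iz = ix \<or> jz = jy \<and> iz = iy" "?n = e * jh + f * jz" "-1 = int e * ih + int f * iz"
      by blast
    define tz where "tz = int jz + int ?n * iz"
    have "int e * th + int f * tz = int (e * jh + f * jz) + int ?n * (int e * ih + int f * iz)"
      by (simp add: t tz_def algebra_simps)
    also have "\<dots> = 0" unfolding z(2,3)[symmetric] by simp
    finally have "int e * th + int f * tz = 0" .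
    moreover have "tz \<ge> 0" using z(1) t_nonneg by (auto simp: tz_def t)
    ultimately have "int e * th = 0 \<and> int f * tz = 0"
      using t_nonneg(1) by (metis add_nonneg_eq_0_iff mult_nonneg_nonneg of_nat_0_le_iff)
    then have "e = 0 \<or> th = 0" "f = 0 \<or> tz = 0"
      unfolding mult_eq_0_iff of_nat_eq_0_iff by blast+
    moreover have "\<not> (e = 0 \<and> f = 0)"
    proof
      assume "e = 0 \<and> f = 0"
      then have "int e * ih + int f * iz = 0" by simp
      then show False using z(3) by linarith
    qed
    ultimately have "th = 0 \<or> tz = 0" by blast
    moreover have "tz = tx \<or> tz = ty" using z(1) unfolding tz_def t by blast
    moreover have "tx = 0" if "th = 0" using t_sum t_nonneg that by simp
    ultimately show ?thesis by blast
  qed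
  show ?thesis
  proof (cases "jx = 0")
    case True
    \<comment> \<open>The determinant in the new coordinates excludes tx = 0, so the image of y lies
      on t = 0 and m divides n.\<close>
    then have "tx * int jh = int ?n" using t_det by simp
    moreover from this have "tx \<noteq> 0" using n by auto
    then have "tx = int ?m * th" using t_ray t_sum by simp
    ultimately have "int ?m * (th * int jh) = int ?n" by simp
    then have "int ?m dvd int ?n" by (metis dvd_triv_left)
    then show ?thesis using n by (simp add: dvd_imp_le)
  next
    case False
    \<comment> \<open>The opposite assignment of the rays contradicts the sign of the
      determinant.\<close>
    then have "jx = ?m * jh" using s_ray sum(1) by simp
    then have "int ?n = int jh * (tx - int ?m * th)"
      using t_det by (simp add: algebra_simps)
    also have "\<dots> = - (int jh * ty)" unfolding t_sum[symmetric] by simp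
    also have "\<dots> \<le> 0" using t_nonneg(3) by simp
    finally show ?thesis using n by simp
  qed
qed

lemma related_polys: "\<exists>\<alpha> \<rho>. \<alpha> \<noteq> 0 \<and> \<rho> \<noteq> 0 \<and> a2 = Polynomial.smult \<rho> (pcompose a1 [:0, \<alpha>:])"
proof -
  interpret inv: gwa_op_iso q a2 a1 \<psi>' by (rule inverse_iso)
  have "\<psi> (mn [:0, 1:] 0) \<noteq> 0" "\<psi>' (mn [:0, 1:] 0) \<noteq> 0"
    by (simp_all add: psi_nonzero inv.psi_nonzero gwa_op_gens)
  then obtain j i k l where ji: "is_monomial (\<psi> (mn [:0, 1:] 0)) j i"
    and kl: "is_monomial (\<psi>' (mn [:0, 1:] 0)) k l"
    using normal_elements[OF degree_a2 psi_normal[OF normal_h]]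
      normal_elements[OF degree_a1 inv.psi_normal[OF normal_h]] by metis
  show ?thesis
  proof (cases "i = 0 \<and> l = 0")
    case True
    \<comment> \<open>\<open>inv.\<psi>'\<close> is again an \<open>inv_into\<close>; it is
      identified with \<psi> at the one argument that matters, h.\<close>
    have "inv.\<psi>' (mn [:0, 1:] 0) = \<psi> (mn [:0, 1:] 0)"
      unfolding inv.\<psi>'_def
    proof (rule inv_into_f_eq)
      show "inj_on \<psi>' (gwa_op a2)" using inv.psi_bij by (simp add: bij_betw_def)
      show "\<psi> (mn [:0, 1:] 0) \<in> gwa_op a2" by (simp add: psi_closed gwa_op_gens)
      show "\<psi>' (\<psi> (mn [:0, 1:] 0)) = mn [:0, 1:] 0"
        unfolding \<psi>'_def using psi_bij gwa_op_gens(1) by (rule bij_betw_inv_into_left)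
    qed
    then obtain \<beta> where \<beta>: "\<beta> \<noteq> 0" "a1 dvd pcompose a2 [:0, \<beta>:]"
      using inv.dvd_if_degree_0 ji kl True by metis
    obtain \<alpha> where \<alpha>: "\<alpha> \<noteq> 0" "a2 dvd pcompose a1 [:0, \<alpha>:]"
      using dvd_if_degree_0 ji kl True by metis
    have nz: "pcompose a1 [:0, \<alpha>:] \<noteq> 0" "pcompose a2 [:0, \<beta>:] \<noteq> 0"
      using a1_nonzero a2_nonzero \<alpha>(1) \<beta>(1) by (simp_all add: pcompose_eq_0_iff)
    have "degree a1 \<le> degree a2"
      using dvd_imp_degree_le[OF \<beta>(2) nz(2)] \<beta>(1) by (simp add: degree_pcompose)
    moreover obtain r where r: "pcompose a1 [:0, \<alpha>:] = a2 * r" using \<alpha>(2) by auto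
    moreover have "r \<noteq> 0" using r nz(1) by auto
    moreover have "degree a1 = degree a2 + degree r"
      using arg_cong[OF r, of degree] \<open>r \<noteq> 0\<close> a2_nonzero \<alpha>(1) by (simp add: degree_mult_eq degree_pcompose)
    \<comment> \<open>The two divisibilities force equal degrees, so the cofactor is a constant and
      \<rho> is its inverse.\<close>
    ultimately have "degree r = 0" by simp
    then obtain c where c: "r = [:c:]" by (rule degree_eq_zeroE)
    then have "c \<noteq> 0" using \<open>r \<noteq> 0\<close> by auto
    then have "a2 = Polynomial.smult (inverse c) (pcompose a1 [:0, \<alpha>:])"
      unfolding r c by simp
    then show ?thesis using \<alpha>(1) \<open>c \<noteq> 0\<close> by (metis inverse_nonzero_iff_nonzero)
  next
    case False
    then have mono: "a1 = monom (lead_coeff a1) (degree a1)" "a2 = monom (lead_coeff a2) (degree a2)"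
      using monomial_if_nonzero_degree[OF ji] inv.monomial_if_nonzero_degree[OF kl] by metis+
    then have "degree a1 = degree a2"
      using degree_le_if_monomials inv.degree_le_if_monomials by simp
    \<comment> \<open>Monomials of equal degree are proportional, so \<alpha> = 1 works.\<close>
    then have "a2 = Polynomial.smult (lead_coeff a2 / lead_coeff a1) (pcompose a1 [:0, 1:])"
      using mono a1_nonzero by (metis leading_coeff_0_iff nonzero_eq_divide_eq pcompose_idR smult_monom)
    then show ?thesis
      using a1_nonzero a2_nonzero by (metis divide_eq_0_iff leading_coeff_0_iff zero_neq_one)
  qed
qed

end

text \<open>The powers of h span k[h], so \<sigma> is determined by the image of h and acts by
  substitution.\<close>

lemma pcompose_if_poly_alg_automorphism:
  assumes "poly_alg_automorphism \<sigma>" "\<sigma> poly_h = f"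
  shows "\<sigma> p = pcompose p f"
proof -
  have add: "\<sigma> (p + r) = \<sigma> p + \<sigma> r" and mult: "\<sigma> (p * r) = \<sigma> p * \<sigma> r"
    and smult: "\<sigma> (Polynomial.smult c p) = Polynomial.smult c (\<sigma> p)" and one: "\<sigma> 1 = 1" for p r c
    using assms(1) unfolding poly_alg_automorphism_def by blast+
  show ?thesis
  proof (induction p)
    case 0
    show ?case using smult[of 0 0] by simp
  next
    case (pCons c p)
    have "pCons c p = Polynomial.smult c 1 + poly_h * p" by simp
    then show ?case
      using pCons by (simp only: add mult smult one assms(2)) (simp add: pcompose_pCons)
  qed
qed

theorem theorem1p1:
  fixes q :: "'k::{alg_closed_field, field_char_0}"
    and a1 a2 :: "'k poly"
    and \<sigma> :: "'k poly \<Rightarrow> 'k poly"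
  assumes "q \<noteq> 0"
    and "\<forall>n::nat. n > 0 \<longrightarrow> q ^ n \<noteq> 1"
    and "degree a1 > 0"
    and "degree a2 > 0"
    and "poly_alg_automorphism \<sigma>"
    and "\<sigma> poly_h = Polynomial.smult q poly_h"
  shows "(\<exists>\<Phi>. \<Phi> \<in> alg_iso (gwa \<sigma> a1) (gwa \<sigma> a2)) \<longleftrightarrow>
    (\<exists>\<alpha> \<rho>. \<alpha> \<noteq> 0 \<and> \<rho> \<noteq> 0 \<and> a2 = Polynomial.smult \<rho> (pcompose a1 [:0, \<alpha>:]))"
proof -
  interpret skew_laurent q
    using assms(1,2) by unfold_locales auto
  have \<sigma>: "\<sigma> p = pcompose p [:0, q:]" for p
    using pcompose_if_poly_alg_automorphism[OF assms(5,6)] by simp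
  have "inv_into UNIV \<sigma> poly_h = [:0, inverse q:]"
  proof (rule inv_f_eq)
    show "inj \<sigma>"
      using assms(5) unfolding poly_alg_automorphism_def by (blast intro: bij_is_inj)
    show "\<sigma> [:0, inverse q:] = poly_h"
      unfolding \<sigma> using assms(1) by (simp add: pcompose_pCons)
  qed
  then have gwa: "gwa \<sigma> a = presented_algebra (gwa_rels a)" for a
    by (simp add: gwa_def gwa_relations_def gwa_rels_def Let_def \<sigma> tw_def pcompose_pCons)
  have nz: "a1 \<noteq> 0" "a2 \<noteq> 0" using assms(3,4) by auto
  have rep: "\<exists>\<Psi>. \<Psi> \<in> alg_iso (gwa \<sigma> a) (op_algebra (range (free_eval (gwa_gens l a))))"
    if "a \<noteq> 0" "l \<noteq> 0" for a l
    unfolding gwa by (intro presented_algebra_iso gwa_kernel that)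
  have rep': "\<exists>\<Psi>. \<Psi> \<in> alg_iso (op_algebra (range (free_eval (gwa_gens l a)))) (gwa \<sigma> a)"
    if "a \<noteq> 0" "l \<noteq> 0" for a l
  proof -
    from rep[OF that] obtain \<Psi>
      where \<Psi>: "\<Psi> \<in> alg_iso (gwa \<sigma> a) (op_algebra (range (free_eval (gwa_gens l a))))" ..
    have "inv_into (carrier (gwa \<sigma> a)) \<Psi> \<in> alg_iso (op_algebra (range (free_eval (gwa_gens l a)))) (gwa \<sigma> a)"
      using \<Psi> unfolding gwa by (rule alg_iso_sym) (rule presented_algebra_closed; assumption)+
    then show ?thesis by (intro exI)
  qed
  show ?thesis
  proof
    assume "\<exists>\<Phi>. \<Phi> \<in> alg_iso (gwa \<sigma> a1) (gwa \<sigma> a2)"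
    \<comment> \<open>The isomorphism is transported to the operator algebras through the
      representations with \<open>l = 1\<close>.\<close>
    then obtain \<psi> where "\<psi> \<in> alg_iso (op_algebra (gwa_op a1)) (op_algebra (gwa_op a2))"
      using rep'[OF nz(1), of 1] rep[OF nz(2), of 1] alg_iso_trans unfolding gwa_op_def by (metis one_neq_zero)
    then interpret gwa_op_iso q a1 a2 \<psi>
      using assms(3,4) by unfold_locales
    show "\<exists>\<alpha> \<rho>. \<alpha> \<noteq> 0 \<and> \<rho> \<noteq> 0 \<and> a2 = Polynomial.smult \<rho> (pcompose a1 [:0, \<alpha>:])"
      by (rule related_polys)
  next
    assume "\<exists>\<alpha> \<rho>. \<alpha> \<noteq> 0 \<and> \<rho> \<noteq> 0 \<and> a2 = Polynomial.smult \<rho> (pcompose a1 [:0, \<alpha>:])"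
    then obtain \<alpha> \<rho> where \<alpha>: "\<alpha> \<noteq> 0" "\<rho> \<noteq> 0" "a2 = Polynomial.smult \<rho> (pcompose a1 [:0, \<alpha>:])"
      by blast
    \<comment> \<open>The parameters \<open>l = \<alpha>\<close> for \<open>a1\<close> and
      \<open>l = 1\<close> for \<open>a2\<close> give the same operators, so the two representations
      can be composed.\<close>
    then have "range (free_eval (gwa_gens \<alpha> a1)) = range (free_eval (gwa_gens 1 a2))"
      using range_gens_scaled[OF \<alpha>] by (simp add: gwa_op_def)
    then show "\<exists>\<Phi>. \<Phi> \<in> alg_iso (gwa \<sigma> a1) (gwa \<sigma> a2)"
      using rep[OF nz(1) \<alpha>(1)] rep'[OF nz(2), of 1] alg_iso_trans by (metis one_neq_zero)
  qed
qed

end
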